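(* Let $k$ be a field, $S$ a finite poset, $\mathbf V=(V,V(s))_{s\in S}$ an $S$-space, and $\mathcal U=\bigoplus_{A\in\hat{\mathcal A}(S)}k_A$. Identify $\lambda\in k$ with the multiplication-by-$\lambda$ map $k\to k$. (a) Let $A=a_1\wedge\dots\wedge a_m$ be in $\hat{\mathcal A}(S)$ and set $V(A)=V(a_1)\cap\dots\cap V(a_m)$ (so $V(\emptyset)=V$). A $k$-linear map $f:k\to V$ gives a morphism $k_A\to\mathbf V$ of $S$-spaces if and only if $f(1)\in V(A)$. The map $f\mapsto f(1)$ is an isomorphism $\mathrm{Hom}_{S\text{-sp}}(k_A,\mathbf V)\cong V(A)$ of $k$-spaces functorial in $\mathbf V$. (Accordingly, $\mathrm{Hom}_{S\text{-sp}}(\mathcal U,\mathbf V)$ is identified with $\bigoplus_{C\in\hat{\mathcal A}(S)}V(C)$, whose elements are written as row vectors $(v_C)_{C\in\hat{\mathcal A}(S)}$ with $v_C\in V(C)$.) (b) If $A,B\in\hat{\mathcal A}(S)$, then $\mathrm{Hom}_{S\text{-sp}}(k_A,k_B)=k$ if $B\le A$, and $\mathrm{Hom}_{S\text{-sp}}(k_A,k_B)=0$ otherwise. (c) Identifying $\mathrm{Hom}_{S\text{-sp}}(k_A,k_B)$ with the subspace $ke_{BA}$ of the matrix algebra $M_{\hat{\mathcal A}(S)}(k)$, for all $B\le A$ in $\hat{\mathcal A}(S)$, identifies the algebra $\mathrm{End}_{S\text{-sp}}\,\mathcal U$ with the incidence algebra $k\hat{\mathcal A}(S)^{\mathrm{op}}$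 of the poset $\hat{\mathcal A}(S)^{\mathrm{op}}$. Then $\mathrm{Hom}_{S\text{-sp}}(\mathcal U,\mathbf V)$ is a left $k\hat{\mathcal A}(S)$-module by means of $e_{AB}\circ\bigl[(v_C)_{C\in\hat{\mathcal A}(S)}\bigr]=(\delta_{CA}v_B)_{C\in\hat{\mathcal A}(S)}$, where $B\le A$ and $\delta_{CA}$ is the Kronecker symbol. (d) There is an isomorphism of functors $\Phi_{\hat a(S)}\,\mathrm{Hom}_{S\text{-sp}}(\mathcal U,-)\cong\mathrm{coind}^{\hat a(S)}_S:S\text{-sp}\to\hat a(S)\text{-sp}$.
   Context: For a finite poset $S$, an $S$-space is a family $\mathbf V=(V,V(s))_{s\in S}$ where $V$ is a finite dimensional $k$-vector space (the ambient space), each $V(s)$ is a subspace of $V$, and $s\le t$ implies $V(s)\subseteq V(t)$. A morphism $f:(U,U(s))\to(V,V(s))$ is a $k$-linear map $f:U\to V$ with $f(U(s))\subseteq V(s)$ for all $s$. Direct sums are componentwise. The category of $S$-spaces is $S\text{-sp}$. $\hat{\mathcal A}(S)$ is the set of all antichains of $S$ (including $\emptyset$) with partial order $\{a_1,\dots,a_m\}\le\{b_1,\dots,b_n\}$ iff for all $j$ there is an $i$ with $a_i\le b_j$; $\emptyset$ is its unique maximal element. $\hat a(S)=\hat{\mathcal A}(S)\setminus\{\emptyset\}$. One writes $a_1\wedge\dots\wedge a_m$ for $\{a_1,\dots,a_m\}$ and identifies $s\in S$ with $\{s\}$, so $S$ is a subposet of $\hat a(S)$. For $A\in\hat{\mathcal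 A}(S)$, $k_A$ is the $S$-space with ambient space $k$ whose subspace at $s\in S$ is $k$ if $s\ge a$ for some $a\in A$, and $0$ otherwise. For a finite poset $P$, $M_P(k)$ is the full matrix algebra with rows and columns indexed by $P$, $e_{xy}$ is the matrix unit with $1$ in row $x$ and column $y$, and the incidence algebra $kP$ is the subalgebra with basis $\{e_{ba}\mid a\le b,\ a,b\in P\}$; thus the incidence algebra $kP^{\mathrm{op}}$ of the opposite poset has basis $\{e_{ab}\mid a\le b \text{ in } P\}$, and transposition gives an antiisomorphism $kP\to kP^{\mathrm{op}}$. For a poset $P$, $P^\omega=P\cup\{\omega\}$ with $x<\omega$ for all $x\in P$. The functor $\Phi_P$ from finitely generated left $kP^\omega$-modules to $P\text{-sp}$ sends $M$ to $(V,V(s))_{s\in P}$ with $V=e_{\omega\omega}M$, $V(s)=e_{\omega s}M$, and $f:M\to N$ to its restriction to $e_{\omega\omega}M$. Here $\hat{\mathcal A}(S)=\hat a(S)^\omega$ with $\omega=\emptyset$. For a subposet $R$ of a poset $P$, $\mathrm{coind}^P_R:R\text{-sp}\to P\text{-sp}$ sends $(V,V(r))_{r\in R}$ to $(V,X(s))_{s\in P}$ with $X(s)=\bigcap_{r\in R,\,s\le r}V(r)$ (equal to $V$ if there is no such $r$) and keeps the underlying linear map of a morphism. *)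

theory Defs
  imports "Jordan_Normal_Form.Missing_VectorSpace"
begin

text \<open>
  Posets are carrier-based (\<open>gorder\<close>), so that the empty poset is included.  Vector spaces
  are those of the AFP entry \<open>VectorSpace\<close>.  Linear maps are functions that are
  \<open>extensional\<close> on the carrier of their domain, so that Hom-sets are honest sets of maps
  and composition is \<open>compose\<close>.
\<close>

section \<open>Linear algebra\<close>

definition self_space :: "('k, 'z) ring_scheme \<Rightarrow> ('k, 'k) module" where
  "self_space K = \<lparr>carrier = carrier K, monoid.mult = monoid.mult K, one = \<one>\<^bsub>K\<^esub>,
     zero = \<zero>\<^bsub>K\<^esub>, add = add K, smult = monoid.mult K\<rparr>"

definition lin_maps ::
  "('r, 'z) ring_scheme \<Rightarrow> ('r, 'v) module \<Rightarrow> ('r, 'w) module \<Rightarrow> ('v \<Rightarrow> 'w) set" where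
  "lin_maps R M N = module_hom R M N \<inter> extensional (carrier M)"

definition vs_iso ::
  "('k, 'z) ring_scheme \<Rightarrow> ('k, 'v) module \<Rightarrow> ('k, 'w) module \<Rightarrow> ('v \<Rightarrow> 'w) \<Rightarrow> bool" where
  "vs_iso K V W T \<longleftrightarrow> linear_map K V W T \<and> bij_betw T (carrier V) (carrier W)"

definition alg_iso ::
  "('k, 'z) ring_scheme \<Rightarrow> ('k, 'v) module \<Rightarrow> ('k, 'w) module \<Rightarrow> ('v \<Rightarrow> 'w) \<Rightarrow> bool" where
  "alg_iso K A B T \<longleftrightarrow> vs_iso K A B T \<and> T \<in> ring_hom A B"

text \<open>Direct sum over a finite index set \<open>I\<close>.  A module record carries ring
  multiplication fields; they play no role for a vector space.\<close>

definition dsum_space :: "'i set \<Rightarrow> ('i \<Rightarrow> ('k, 'v) module) \<Rightarrow> ('k, 'i \<Rightarrow> 'v) module" where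
  "dsum_space I M = \<lparr>carrier = (\<Pi>\<^sub>E i\<in>I. carrier (M i)), monoid.mult = undefined, one = undefined,
     zero = (\<lambda>i\<in>I. \<zero>\<^bsub>M i\<^esub>), add = (\<lambda>x y. \<lambda>i\<in>I. x i \<oplus>\<^bsub>M i\<^esub> y i),
     smult = (\<lambda>c x. \<lambda>i\<in>I. c \<odot>\<^bsub>M i\<^esub> x i)\<rparr>"

definition dsum_inj :: "'i set \<Rightarrow> ('i \<Rightarrow> ('k, 'v) module) \<Rightarrow> 'i \<Rightarrow> 'v \<Rightarrow> 'i \<Rightarrow> 'v" where
  "dsum_inj I M i x = (\<lambda>j\<in>I. if j = i then x else \<zero>\<^bsub>M j\<^esub>)"

definition dsum_proj :: "'i \<Rightarrow> ('i \<Rightarrow> 'v) \<Rightarrow> 'v" where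
  "dsum_proj i u = u i"

section \<open>Modules over noncommutative rings\<close>

text \<open>\<open>HOL-Algebra\<close> has modules over commutative rings only.\<close>

locale left_module = R?: ring R + M?: abelian_group M
  for R :: "('r, 'z) ring_scheme" (structure) and M :: "('r, 'm, 'y) module_scheme" (structure) +
  assumes lsmult_closed: "\<lbrakk>a \<in> carrier R; x \<in> carrier M\<rbrakk> \<Longrightarrow> a \<odot>\<^bsub>M\<^esub> x \<in> carrier M"
    and lsmult_l_distr: "\<lbrakk>a \<in> carrier R; b \<in> carrier R; x \<in> carrier M\<rbrakk> \<Longrightarrow>
      (a \<oplus> b) \<odot>\<^bsub>M\<^esub> x = a \<odot>\<^bsub>M\<^esub> x \<oplus>\<^bsub>M\<^esub> b \<odot>\<^bsub>M\<^esub> x"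
    and lsmult_r_distr: "\<lbrakk>a \<in> carrier R; x \<in> carrier M; y \<in> carrier M\<rbrakk> \<Longrightarrow>
      a \<odot>\<^bsub>M\<^esub> (x \<oplus>\<^bsub>M\<^esub> y) = a \<odot>\<^bsub>M\<^esub> x \<oplus>\<^bsub>M\<^esub> a \<odot>\<^bsub>M\<^esub> y"
    and lsmult_assoc: "\<lbrakk>a \<in> carrier R; b \<in> carrier R; x \<in> carrier M\<rbrakk> \<Longrightarrow>
      (a \<otimes> b) \<odot>\<^bsub>M\<^esub> x = a \<odot>\<^bsub>M\<^esub> (b \<odot>\<^bsub>M\<^esub> x)"
    and lsmult_one: "x \<in> carrier M \<Longrightarrow> \<one> \<odot>\<^bsub>M\<^esub> x = x"

definition fin_gen :: "('r, 'z) ring_scheme \<Rightarrow> ('r, 'm) module \<Rightarrow> bool" where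
  "fin_gen R M \<longleftrightarrow> (\<exists>G. finite G \<and> G \<subseteq> carrier M \<and>
     (\<forall>x\<in>carrier M. \<exists>c\<in>G \<rightarrow> carrier R. x = (\<Oplus>\<^bsub>M\<^esub>g\<in>G. c g \<odot>\<^bsub>M\<^esub> g)))"

section \<open>Spaces over a poset\<close>

record ('k, 'v, 's) sspace =
  amb :: "('k, 'v) module"
  sub :: "'s \<Rightarrow> 'v set"

definition poset_space :: "('k, 'z) ring_scheme \<Rightarrow> 's gorder \<Rightarrow> ('k, 'v, 's) sspace \<Rightarrow> bool" where
  "poset_space K P V \<longleftrightarrow> vectorspace K (amb V) \<and> vectorspace.fin_dim K (amb V) \<and>
     (\<forall>s\<in>carrier P. subspace K (sub V s) (amb V)) \<and>
     (\<forall>s\<in>carrier P. \<forall>t\<in>carrier P. s \<sqsubseteq>\<^bsub>P\<^esub> t \<longrightarrow> sub V s \<subseteq> sub V t)"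

definition sp_hom :: "('k, 'z) ring_scheme \<Rightarrow> 's gorder \<Rightarrow>
    ('k, 'v, 's) sspace \<Rightarrow> ('k, 'w, 's) sspace \<Rightarrow> ('v \<Rightarrow> 'w) set" where
  "sp_hom K P U V =
     {f \<in> lin_maps K (amb U) (amb V). \<forall>s\<in>carrier P. f ` sub U s \<subseteq> sub V s}"

definition sp_iso :: "('k, 'z) ring_scheme \<Rightarrow> 's gorder \<Rightarrow>
    ('k, 'v, 's) sspace \<Rightarrow> ('k, 'w, 's) sspace \<Rightarrow> ('v \<Rightarrow> 'w) \<Rightarrow> bool" where
  "sp_iso K P U V f \<longleftrightarrow> f \<in> sp_hom K P U V \<and>
     (\<exists>g\<in>sp_hom K P V U. (\<forall>x\<in>carrier (amb U). g (f x) = x) \<and>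
                         (\<forall>y\<in>carrier (amb V). f (g y) = y))"

definition hom_space :: "('k, 'z) ring_scheme \<Rightarrow> 's gorder \<Rightarrow>
    ('k, 'v, 's) sspace \<Rightarrow> ('k, 'w, 's) sspace \<Rightarrow> ('k, 'v \<Rightarrow> 'w) module" where
  "hom_space K P U V = \<lparr>carrier = sp_hom K P U V, monoid.mult = undefined, one = undefined,
     zero = (\<lambda>x\<in>carrier (amb U). \<zero>\<^bsub>amb V\<^esub>),
     add = (\<lambda>f g. \<lambda>x\<in>carrier (amb U). f x \<oplus>\<^bsub>amb V\<^esub> g x),
     smult = (\<lambda>c f. \<lambda>x\<in>carrier (amb U). c \<odot>\<^bsub>amb V\<^esub> f x)\<rparr>"

definition end_alg :: "('k, 'z) ring_scheme \<Rightarrow> 's gorder \<Rightarrow>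
    ('k, 'v, 's) sspace \<Rightarrow> ('k, 'v \<Rightarrow> 'v) module" where
  "end_alg K P U = (hom_space K P U U)
     \<lparr>monoid.mult := compose (carrier (amb U)), one := (\<lambda>x\<in>carrier (amb U). x)\<rparr>"

definition dsum_sp :: "'i set \<Rightarrow> ('i \<Rightarrow> ('k, 'v, 's) sspace) \<Rightarrow> ('k, 'i \<Rightarrow> 'v, 's) sspace" where
  "dsum_sp I X = \<lparr>amb = dsum_space I (\<lambda>i. amb (X i)), sub = (\<lambda>s. \<Pi>\<^sub>E i\<in>I. sub (X i) s)\<rparr>"

section \<open>Antichains\<close>

definition Ahat :: "'s gorder \<Rightarrow> 's set gorder" where
  "Ahat S = \<lparr>carrier = {A. A \<subseteq> carrier S \<and> (\<forall>a\<in>A. \<forall>b\<in>A. a \<sqsubseteq>\<^bsub>S\<^esub> b \<longrightarrow> a = b)}, eq = (=),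
     le = (\<lambda>A B. \<forall>b\<in>B. \<exists>a\<in>A. a \<sqsubseteq>\<^bsub>S\<^esub> b)\<rparr>"

definition ahat :: "'s gorder \<Rightarrow> 's set gorder" where
  "ahat S = (Ahat S)\<lparr>carrier := carrier (Ahat S) - {{}}\<rparr>"

text \<open>The extension of \<open>P\<close> by a new maximum \<open>w\<close>, for \<open>w \<notin> carrier P\<close>.\<close>

definition omega_ext :: "'p gorder \<Rightarrow> 'p \<Rightarrow> 'p gorder" where
  "omega_ext P w = \<lparr>carrier = insert w (carrier P), eq = (=),
     le = (\<lambda>x y. y = w \<or> x \<noteq> w \<and> x \<sqsubseteq>\<^bsub>P\<^esub> y)\<rparr>"

lemma omega_ext_ahat: "omega_ext (ahat S) {} = Ahat S"
proof -
  have "{} \<in> carrier (Ahat S)" by (simp add: Ahat_def)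
  then have "insert {} (carrier (Ahat S) - {{}}) = carrier (Ahat S)" by blast
  then show ?thesis
    by (auto simp: omega_ext_def ahat_def Ahat_def fun_eq_iff)
qed

text \<open>The identification of \<open>s\<close> with \<open>{s}\<close> makes \<open>S\<close> a subposet of \<open>ahat S\<close>.\<close>

lemma singleton_embedding:
  assumes "s \<in> carrier S" "t \<in> carrier S"
  shows "{s} \<in> carrier (ahat S)" and "{s} \<sqsubseteq>\<^bsub>ahat S\<^esub> {t} \<longleftrightarrow> s \<sqsubseteq>\<^bsub>S\<^esub> t"
  using assms by (auto simp: ahat_def Ahat_def)

definition kA :: "('k, 'z) ring_scheme \<Rightarrow> 's gorder \<Rightarrow> 's set \<Rightarrow> ('k, 'k, 's) sspace" where
  "kA K S A = \<lparr>amb = self_space K,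
     sub = (\<lambda>s. if \<exists>a\<in>A. a \<sqsubseteq>\<^bsub>S\<^esub> s then carrier K else {\<zero>\<^bsub>K\<^esub>})\<rparr>"

definition Usp :: "('k, 'z) ring_scheme \<Rightarrow> 's gorder \<Rightarrow> ('k, 's set \<Rightarrow> 'k, 's) sspace" where
  "Usp K S = dsum_sp (carrier (Ahat S)) (kA K S)"

definition Uinj :: "('k, 'z) ring_scheme \<Rightarrow> 's gorder \<Rightarrow> 's set \<Rightarrow> 'k \<Rightarrow> 's set \<Rightarrow> 'k" where
  "Uinj K S = dsum_inj (carrier (Ahat S)) (\<lambda>A. amb (kA K S A))"

text \<open>The subspace \<open>V(A)\<close>, for an antichain \<open>A\<close>; it is the ambient space if \<open>A = {}\<close>.\<close>

definition meet_space :: "('k, 'v, 's) sspace \<Rightarrow> 's set \<Rightarrow> ('k, 'v) module" where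
  "meet_space V A = (amb V)\<lparr>carrier := {v \<in> carrier (amb V). \<forall>a\<in>A. v \<in> sub V a}\<rparr>"

text \<open>The row vector of a morphism \<open>f\<close> from \<open>Usp K S\<close>: its entry at \<open>C\<close> is the value at \<open>1\<close>
  of the restriction of \<open>f\<close> to the summand \<open>kA K S C\<close>.\<close>

definition rowvec :: "('k, 'z) ring_scheme \<Rightarrow> 's gorder \<Rightarrow> (('s set \<Rightarrow> 'k) \<Rightarrow> 'v) \<Rightarrow> 's set \<Rightarrow> 'v" where
  "rowvec K S f = (\<lambda>C\<in>carrier (Ahat S). f (Uinj K S C \<one>\<^bsub>K\<^esub>))"

section \<open>Incidence algebras\<close>

text \<open>The matrix algebra with rows and columns indexed by a finite poset \<open>P\<close>; the pair \<open>(x, y)\<close>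
  is the position in row \<open>x\<close> and column \<open>y\<close>.\<close>

definition mat_alg :: "('k, 'z) ring_scheme \<Rightarrow> 'p gorder \<Rightarrow> ('k, 'p \<times> 'p \<Rightarrow> 'k) module" where
  "mat_alg K P = (let I = carrier P \<times> carrier P in
     \<lparr>carrier = I \<rightarrow>\<^sub>E carrier K,
      monoid.mult = (\<lambda>M N. \<lambda>(x, z)\<in>I. \<Oplus>\<^bsub>K\<^esub>y\<in>carrier P. M (x, y) \<otimes>\<^bsub>K\<^esub> N (y, z)),
      one = (\<lambda>(x, y)\<in>I. if x = y then \<one>\<^bsub>K\<^esub> else \<zero>\<^bsub>K\<^esub>),
      zero = (\<lambda>i\<in>I. \<zero>\<^bsub>K\<^esub>),
      add = (\<lambda>M N. \<lambda>i\<in>I. M i \<oplus>\<^bsub>K\<^esub> N i),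
      smult = (\<lambda>c M. \<lambda>i\<in>I. c \<otimes>\<^bsub>K\<^esub> M i)\<rparr>)"

definition mat_unit :: "('k, 'z) ring_scheme \<Rightarrow> 'p gorder \<Rightarrow> 'p \<Rightarrow> 'p \<Rightarrow> 'p \<times> 'p \<Rightarrow> 'k" where
  "mat_unit K P x y =
     (\<lambda>i\<in>carrier P \<times> carrier P. if i = (x, y) then \<one>\<^bsub>K\<^esub> else \<zero>\<^bsub>K\<^esub>)"

definition mat_transpose :: "'p gorder \<Rightarrow> ('p \<times> 'p \<Rightarrow> 'k) \<Rightarrow> 'p \<times> 'p \<Rightarrow> 'k" where
  "mat_transpose P M = (\<lambda>(x, y)\<in>carrier P \<times> carrier P. M (y, x))"

definition incidence :: "('k, 'z) ring_scheme \<Rightarrow> 'p gorder \<Rightarrow> ('k, 'p \<times> 'p \<Rightarrow> 'k) module" where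
  "incidence K P = (mat_alg K P)\<lparr>carrier := LinearCombinations.module.span K (mat_alg K P)
     {mat_unit K P b a | a b. a \<in> carrier P \<and> b \<in> carrier P \<and> a \<sqsubseteq>\<^bsub>P\<^esub> b}\<rparr>"

section \<open>The space of morphisms from \<open>Usp\<close> as a module\<close>

text \<open>The matrix of an endomorphism of \<open>Usp K S\<close>: its \<open>(B, A)\<close> entry is the value at \<open>1\<close> of the
  component from \<open>kA K S A\<close> to \<open>kA K S B\<close>.\<close>

definition end_mat :: "('k, 'z) ring_scheme \<Rightarrow> 's gorder \<Rightarrow>
    (('s set \<Rightarrow> 'k) \<Rightarrow> ('s set \<Rightarrow> 'k)) \<Rightarrow> 's set \<times> 's set \<Rightarrow> 'k" where
  "end_mat K S f = (\<lambda>(B, A)\<in>carrier (Ahat S) \<times> carrier (Ahat S).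
     dsum_proj B (f (Uinj K S A \<one>\<^bsub>K\<^esub>)))"

text \<open>Endomorphisms of \<open>Usp K S\<close> act on the right by composition; via \<open>end_mat\<close> and
  transposition this becomes a left action of the incidence algebra of \<open>Ahat S\<close>.\<close>

definition HomU :: "('k, 'z) ring_scheme \<Rightarrow> 's gorder \<Rightarrow> ('k, 'v, 's) sspace \<Rightarrow>
    ('s set \<times> 's set \<Rightarrow> 'k, ('s set \<Rightarrow> 'k) \<Rightarrow> 'v) module" where
  "HomU K S V = (let H = hom_space K S (Usp K S) V in
     \<lparr>carrier = carrier H, monoid.mult = undefined, one = undefined, zero = \<zero>\<^bsub>H\<^esub>, add = add H,
      smult = (\<lambda>x f. compose (carrier (amb (Usp K S))) f
        (inv_into (carrier (end_alg K S (Usp K S))) (end_mat K S)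
          (mat_transpose (Ahat S) x)))\<rparr>)"

definition HomU_map :: "('k, 'z) ring_scheme \<Rightarrow> 's gorder \<Rightarrow> ('k, 'v, 's) sspace \<Rightarrow>
    ('k, 'v, 's) sspace \<Rightarrow> ('v \<Rightarrow> 'v) \<Rightarrow> (('s set \<Rightarrow> 'k) \<Rightarrow> 'v) \<Rightarrow> (('s set \<Rightarrow> 'k) \<Rightarrow> 'v)" where
  "HomU_map K S V W g =
     (\<lambda>f\<in>sp_hom K S (Usp K S) V. compose (carrier (amb (Usp K S))) g f)"

section \<open>The functors \<open>Phi\<close> and \<open>coind\<close>\<close>

text \<open>A module over a \<open>K\<close>-algebra \<open>R\<close> is a \<open>K\<close>-space by means of \<open>c m = (c 1) m\<close>.\<close>

definition Phi :: "('k, 'z) ring_scheme \<Rightarrow> 'p gorder \<Rightarrow> 'p \<Rightarrow>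
    ('p \<times> 'p \<Rightarrow> 'k, 'm) module \<Rightarrow> ('k, 'm, 'p) sspace" where
  "Phi K P w M = (let Q = omega_ext P w; R = incidence K Q in
     \<lparr>amb = \<lparr>carrier = (\<lambda>m. mat_unit K Q w w \<odot>\<^bsub>M\<^esub> m) ` carrier M,
         monoid.mult = undefined, one = undefined, zero = \<zero>\<^bsub>M\<^esub>, add = add M,
         smult = (\<lambda>c m. (c \<odot>\<^bsub>R\<^esub> \<one>\<^bsub>R\<^esub>) \<odot>\<^bsub>M\<^esub> m)\<rparr>,
      sub = (\<lambda>s. (\<lambda>m. mat_unit K Q w s \<odot>\<^bsub>M\<^esub> m) ` carrier M)\<rparr>)"

definition Phi_map :: "('k, 'z) ring_scheme \<Rightarrow> 'p gorder \<Rightarrow> 'p \<Rightarrow>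
    ('p \<times> 'p \<Rightarrow> 'k, 'm) module \<Rightarrow> ('p \<times> 'p \<Rightarrow> 'k, 'm) module \<Rightarrow> ('m \<Rightarrow> 'm) \<Rightarrow> ('m \<Rightarrow> 'm)" where
  "Phi_map K P w M N f = restrict f (carrier (amb (Phi K P w M)))"

text \<open>Coinduction along the inclusion \<open>i\<close> of a subposet \<open>R\<close> into \<open>P\<close>.\<close>

definition coind :: "'p gorder \<Rightarrow> 'r gorder \<Rightarrow> ('r \<Rightarrow> 'p) \<Rightarrow>
    ('k, 'v, 'r) sspace \<Rightarrow> ('k, 'v, 'p) sspace" where
  "coind P R i V = \<lparr>amb = amb V,
     sub = (\<lambda>s. {v \<in> carrier (amb V). \<forall>r\<in>carrier R. s \<sqsubseteq>\<^bsub>P\<^esub> i r \<longrightarrow> v \<in> sub V r})\<rparr>"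

definition coind_map ::
    "('k, 'v, 'r) sspace \<Rightarrow> ('k, 'v, 'r) sspace \<Rightarrow> ('v \<Rightarrow> 'v) \<Rightarrow> ('v \<Rightarrow> 'v)" where
  "coind_map V W f = f"

section \<open>Categories and functors\<close>

text \<open>Concrete categories whose objects have an underlying set in a fixed type and whose morphisms
  are functions extensional on it; identities and composition are those of functions.\<close>

record ('o, 'x) ccat =
  objs :: "'o set"
  homs :: "'o \<Rightarrow> 'o \<Rightarrow> ('x \<Rightarrow> 'x) set"
  und :: "'o \<Rightarrow> 'x set"

definition sp_cat :: "('k, 'z) ring_scheme \<Rightarrow> 's gorder \<Rightarrow> (('k, 'v, 's) sspace, 'v) ccat" where
  "sp_cat K P = \<lparr>objs = {V. poset_space K P V}, homs = sp_hom K P,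
     und = (\<lambda>V. carrier (amb V))\<rparr>"

definition fgmod_cat :: "('r, 'z) ring_scheme \<Rightarrow> (('r, 'm) module, 'm) ccat" where
  "fgmod_cat R = \<lparr>objs = {M. left_module R M \<and> fin_gen R M}, homs = lin_maps R,
     und = carrier\<rparr>"

definition is_functor :: "('o, 'x) ccat \<Rightarrow> ('p, 'y) ccat \<Rightarrow> ('o \<Rightarrow> 'p) \<Rightarrow>
    ('o \<Rightarrow> 'o \<Rightarrow> ('x \<Rightarrow> 'x) \<Rightarrow> ('y \<Rightarrow> 'y)) \<Rightarrow> bool" where
  "is_functor C D F Fm \<longleftrightarrow>
     (\<forall>X\<in>objs C. F X \<in> objs D) \<and>
     (\<forall>X\<in>objs C. \<forall>Y\<in>objs C. \<forall>f\<in>homs C X Y. Fm X Y f \<in> homs D (F X) (F Y)) \<and>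
     (\<forall>X\<in>objs C. Fm X X (\<lambda>x\<in>und C X. x) = (\<lambda>x\<in>und D (F X). x)) \<and>
     (\<forall>X\<in>objs C. \<forall>Y\<in>objs C. \<forall>Z\<in>objs C. \<forall>f\<in>homs C X Y. \<forall>g\<in>homs C Y Z.
        Fm X Z (compose (und C X) g f) = compose (und D (F X)) (Fm Y Z g) (Fm X Y f))"

text \<open>Isomorphism of two functors from \<open>C\<close> to the category of \<open>P\<close>-spaces.  The ambient spaces of
  their values may live in different types, which is why the target is not a single \<open>ccat\<close>.\<close>

definition sp_functors_iso :: "('k, 'z) ring_scheme \<Rightarrow> 'p gorder \<Rightarrow> ('o, 'x) ccat \<Rightarrow>
    ('o \<Rightarrow> ('k, 'v, 'p) sspace) \<Rightarrow> ('o \<Rightarrow> 'o \<Rightarrow> ('x \<Rightarrow> 'x) \<Rightarrow> ('v \<Rightarrow> 'v)) \<Rightarrow>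
    ('o \<Rightarrow> ('k, 'w, 'p) sspace) \<Rightarrow> ('o \<Rightarrow> 'o \<Rightarrow> ('x \<Rightarrow> 'x) \<Rightarrow> ('w \<Rightarrow> 'w)) \<Rightarrow> bool" where
  "sp_functors_iso K P C F Fm G Gm \<longleftrightarrow>
     is_functor C (sp_cat K P) F Fm \<and> is_functor C (sp_cat K P) G Gm \<and>
     (\<exists>\<eta>. (\<forall>X\<in>objs C. sp_iso K P (F X) (G X) (\<eta> X)) \<and>
       (\<forall>X\<in>objs C. \<forall>Y\<in>objs C. \<forall>f\<in>homs C X Y. \<forall>x\<in>carrier (amb (F X)).
          \<eta> Y (Fm X Y f x) = Gm X Y f (\<eta> X x)))"

end

theory Submission
  imports "HOL-Algebra.Subrings" Defs
begin

text \<open>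
  A morphism \<open>f\<close> from the direct sum \<open>\<U>\<close> of the \<open>k\<^sub>A\<close> is determined by its values \<open>f (e A)\<close>
  at the unit vectors \<open>e A\<close> of the summands, and these values range freely over the spaces \<open>V(A)\<close>.
  For \<open>V = \<U>\<close> the space \<open>V(A)\<close> consists of the vectors that vanish at all \<open>B\<close> with \<open>\<not> B \<le> A\<close>, so
  the matrices of endomorphisms are exactly those of the incidence algebra of the opposite poset.
  A matrix \<open>x\<close> acts on the row vector of \<open>f\<close> as on a column; in particular \<open>e\<^sub>\<omega>\<^sub>B\<close> sends \<open>f\<close> to
  the morphism that takes the value \<open>f (e B)\<close> at \<open>e \<omega>\<close> and vanishes on the other summands.
  Evaluation at \<open>e \<omega>\<close> therefore identifies \<open>e\<^sub>\<omega>\<^sub>B Hom(\<U>, V)\<close> with \<open>V(B)\<close>, the value of coinduction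
  at \<open>B\<close>.
\<close>

section \<open>Vector spaces and direct sums\<close>

text \<open>The order on antichains enters through up-sets: k_A is nonzero exactly at the elements
  above some element of \<open>A\<close>, so a nonzero scalar is a morphism from k_A to k_B iff the
  up-set of \<open>A\<close> lies in that of \<open>B\<close>, and this is \<open>B\<close> \<le>
  \<open>A\<close>. Two conventions have to meet. The matrix of an endomorphism has the target as
  row and the source as column, so its nonzero entries (B, A) satisfy B \<le> A; the incidence
  algebra of \<open>Ahat S\<close> has the transposed pattern. Endomorphisms act on morphisms out of
  the sum by precomposition, hence from the right. Transposition matches the two patterns and
  reverses products, which turns this into a left action. The summand at \<open>{}\<close> is
  singled out because \<open>{}\<close> is the maximum: k at \<open>{}\<close> has all its subspaces
  zero and V at \<open>{}\<close> is the whole ambient space, so evaluation there sees all of V, and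
  every matrix unit in row \<open>{}\<close> lies in the algebra. Much of the bookkeeping comes from
  one set of maps carrying several records (\<open>hom_space\<close>, \<open>end_alg\<close>,
  \<open>HomU\<close>, the ambient space of \<open>Phi\<close>). Vector space axioms are therefore
  pulled back along injections that respect the operations, often the identity function.\<close>

lemma vectorspace_transfer:
  assumes "vectorspace K V" and T: "T \<in> carrier W \<rightarrow> carrier V" "inj_on T (carrier W)"
    and zero: "\<zero>\<^bsub>W\<^esub> \<in> carrier W" "T \<zero>\<^bsub>W\<^esub> = \<zero>\<^bsub>V\<^esub>"
    and add: "\<And>x y. x \<in> carrier W \<Longrightarrow> y \<in> carrier W \<Longrightarrow> x \<oplus>\<^bsub>W\<^esub> y \<in> carrier W"
      "\<And>x y. x \<in> carrier W \<Longrightarrow> y \<in> carrier W \<Longrightarrow> T (x \<oplus>\<^bsub>W\<^esub> y) = T x \<oplus>\<^bsub>V\<^esub> T y"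
    and smult: "\<And>c x. c \<in> carrier K \<Longrightarrow> x \<in> carrier W \<Longrightarrow> c \<odot>\<^bsub>W\<^esub> x \<in> carrier W"
      "\<And>c x. c \<in> carrier K \<Longrightarrow> x \<in> carrier W \<Longrightarrow> T (c \<odot>\<^bsub>W\<^esub> x) = c \<odot>\<^bsub>V\<^esub> T x"
  shows "vectorspace K W"
proof -
  interpret V: vectorspace K V by fact
  have mem: "T x \<in> carrier V" if "x \<in> carrier W" for x using T that by auto
  note hom = mem zero add smult
  note eqI = inj_onD[OF T(2)]
  show ?thesis
  proof (rule vs_criteria, goal_cases)
    case 1 show ?case by (rule V.field_axioms)
  next
    case 4
    have "\<exists>y\<in>carrier W. x \<oplus>\<^bsub>W\<^esub> y = \<zero>\<^bsub>W\<^esub>" if x: "x \<in> carrier W" for x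
    proof (rule bexI)
      \<comment> \<open>The record \<open>W\<close> is only known to be closed under scalars, so the
        negative of x is produced as (-1) x.\<close>
      show y: "(\<ominus>\<^bsub>K\<^esub> \<one>\<^bsub>K\<^esub>) \<odot>\<^bsub>W\<^esub> x \<in> carrier W" using x smult by simp
      show "x \<oplus>\<^bsub>W\<^esub> (\<ominus>\<^bsub>K\<^esub> \<one>\<^bsub>K\<^esub>) \<odot>\<^bsub>W\<^esub> x = \<zero>\<^bsub>W\<^esub>"
        by (rule eqI) (use x y in \<open>auto simp: hom V.smult_minus_1 V.r_neg\<close>)
    qed
    then show ?case by blast
  next
    case 6 then show ?case by (auto intro!: eqI simp: hom V.M.a_comm)
  next
    case 7 then show ?case by (auto intro!: eqI simp: hom V.M.a_assoc)
  next
    case 8 then show ?case by (auto intro!: eqI simp: hom)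
  next
    case 9 then show ?case by (auto intro!: eqI simp: hom V.smult_assoc1)
  next
    case 10 then show ?case by (auto intro!: eqI simp: hom)
  next
    case 11 then show ?case by (auto intro!: eqI simp: hom V.smult_l_distr)
  next
    case 12 then show ?case by (auto intro!: eqI simp: hom V.smult_r_distr)
  qed (auto simp: hom)
qed

lemma vectorspace_self_space:
  assumes "field K"
  shows "vectorspace K (self_space K)"
proof -
  interpret field K by fact
  show ?thesis
    by (rule vs_criteria)
      (auto simp: self_space_def assms r_distr l_distr m_assoc a_ac intro!: bexI[of _ "\<ominus>\<^bsub>K\<^esub> _"] r_neg)
qed

lemma vectorspace_dsum_space:
  assumes "field K" and vs: "\<And>i. i \<in> I \<Longrightarrow> vectorspace K (M i)"
  shows "vectorspace K (dsum_space I M)"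
proof -
  have m: "Module.module K (M i)" "abelian_group (M i)" "abelian_monoid (M i)" if "i \<in> I" for i
    using vs[OF that] by (auto simp: vectorspace_def module_def abelian_group_def)
  show ?thesis
  proof (rule vs_criteria, goal_cases)
    case 1 show ?case by fact
  next
    case 4
    have "\<exists>y\<in>\<Pi>\<^sub>E i\<in>I. carrier (M i). (\<lambda>i\<in>I. x i \<oplus>\<^bsub>M i\<^esub> y i) = (\<lambda>i\<in>I. \<zero>\<^bsub>M i\<^esub>)"
      if "x \<in> (\<Pi>\<^sub>E i\<in>I. carrier (M i))" for x
      using that
      by (intro bexI[of _ "\<lambda>i\<in>I. \<ominus>\<^bsub>M i\<^esub> x i"])
        (auto simp: fun_eq_iff PiE_def Pi_def m abelian_group.r_neg abelian_group.a_inv_closed)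
    then show ?case by (simp add: dsum_space_def)
  next
    case 8 then show ?case
      by (auto simp: dsum_space_def fun_eq_iff PiE_iff extensional_def m abelian_monoid.r_zero)
  next
    case 10 then show ?case
      by (auto simp: dsum_space_def fun_eq_iff PiE_iff extensional_def m module.smult_one)
  next
    case 6 then show ?case
      by (auto simp: dsum_space_def fun_eq_iff PiE_iff m intro!: abelian_monoid.a_comm)
  next
    case 7 then show ?case
      by (auto simp: dsum_space_def fun_eq_iff PiE_iff m intro!: abelian_monoid.a_assoc)
  next
    case 9 then show ?case
      by (auto simp: dsum_space_def fun_eq_iff PiE_iff m intro!: module.smult_assoc1)
  next
    case 11 then show ?case
      by (auto simp: dsum_space_def fun_eq_iff PiE_iff m intro!: module.smult_l_distr)
  next
    case 12 then show ?case
      by (auto simp: dsum_space_def fun_eq_iff PiE_iff m intro!: module.smult_r_distr)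
  qed (auto simp: dsum_space_def PiE_iff m abelian_monoid.a_closed abelian_monoid.zero_closed intro!: module.smult_closed)
qed

text \<open>For infinite \<open>A\<close> the sum is zero by convention, and zero lies in
  \<open>N\<close>; the induction covers this case as well.\<close>

lemma submodule_finsum_closed:
  assumes "submodule K N M" and "f \<in> A \<rightarrow> N"
  shows "finsum M f A \<in> N"
proof -
  interpret submodule K N M by fact
  interpret M: Module.module K M by (rule module)
  show ?thesis
    using assms(2)
  proof (induction A rule: infinite_finite_induct)
    case (insert a A)
    then have "f \<in> A \<rightarrow> carrier M" "f a \<in> carrier M" using subset by auto
    then show ?case using insert by (simp add: m_closed Pi_iff)
  qed auto
qed

lemma submodule_preimage:
  assumes "linear_map K V W T" and "submodule K N W"
  shows "submodule K {v \<in> carrier V. T v \<in> N} V"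
proof -
  interpret linear_map K V W T by fact
  interpret N: submodule K N W by fact
  show ?thesis by unfold_locales (auto simp: T_add T_smult)
qed

lemma linear_mapI:
  assumes "vectorspace K V" "vectorspace K W" "T \<in> module_hom K V W"
  shows "linear_map K V W T"
  using assms
  by (auto simp: linear_map_def mod_hom_def mod_hom_axioms_def vectorspace_def)

lemma linear_map_image_span:
  assumes "linear_map K V W T" and "A \<subseteq> carrier V"
  shows "T ` LinearCombinations.module.span K V A \<subseteq> LinearCombinations.module.span K W (T ` A)"
proof -
  interpret V: vectorspace K V by (rule linear_map.axioms(1)) fact
  interpret W: vectorspace K W by (rule linear_map.axioms(2)) fact
  interpret T: linear_map K V W T by fact
  have TA: "T ` A \<subseteq> carrier W" using assms(2) by auto
  have "V.span A \<subseteq> {v \<in> carrier V. T v \<in> W.span (T ` A)}"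
    using W.in_own_span[OF TA] assms(2)
    by (intro V.span_is_subset submodule_preimage[OF assms(1)] W.span_is_submodule TA) auto
  then show ?thesis by auto
qed

section \<open>Finite dimension and expansion into components\<close>

lemma fin_dim_vs_iso:
  assumes "vs_iso K V W T" and "vectorspace.fin_dim K V"
  shows "vectorspace.fin_dim K W"
proof -
  interpret linear_map K V W T using assms(1) by (simp add: vs_iso_def)
  show ?thesis using assms by (intro rank_nullity_main(2)) (auto simp: vs_iso_def bij_betw_def)
qed

lemma vs_iso_inv:
  assumes "vs_iso K V W T"
  shows "vs_iso K W V (inv_into (carrier V) T)"
proof -
  interpret linear_map K V W T using assms by (simp add: vs_iso_def)
  have bij: "bij_betw T (carrier V) (carrier W)" using assms by (simp add: vs_iso_def)
  let ?g = "inv_into (carrier V) T"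
  have g: "?g w \<in> carrier V" "T (?g w) = w" if "w \<in> carrier W" for w
    using that bij by (auto simp: bij_betw_def inv_into_into f_inv_into_f)
  have "?g \<in> module_hom K W V"
    by (auto simp: module_hom_def g intro!: inj_onD[OF bij_betw_imp_inj_on[OF bij]])
  then show ?thesis
    using bij_betw_inv_into[OF bij]
    by (auto simp: vs_iso_def intro!: linear_mapI W.vectorspace_axioms V.vectorspace_axioms)
qed

text \<open>Independence in \<open>W\<close> is independence in \<open>V\<close>, so independent
  subsets of \<open>W\<close> have at most dim V elements. A maximal one therefore exists, and it
  generates \<open>W\<close>.\<close>

lemma fin_dim_subspace:
  assumes "vectorspace.fin_dim K V" and "subspace K W V"
  shows "vectorspace.fin_dim K (V\<lparr>carrier := W\<rparr>)"
proof -
  interpret V: vectorspace K V using assms(2) by (simp add: subspace_def)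
  interpret W: vectorspace K "V\<lparr>carrier := W\<rparr>" by (rule V.subspace_is_vs) fact
  have sub: "submodule K W V" using assms(2) by (simp add: subspace_def)
  then have WV: "W \<subseteq> carrier V" by (rule submodule.subset)
  have "W.lin_indpt {}" by (auto simp: W.lin_dep_def)
  moreover have "finite B \<and> card B \<le> V.dim" if "B \<subseteq> W" "W.lin_indpt B" for B
    using V.li_le_dim[OF assms(1), of B] V.span_li_not_depend(2)[OF that(1) sub] WV that by auto
  ultimately obtain A where A: "finite A"
    "maximal A (\<lambda>B. B \<subseteq> carrier (V\<lparr>carrier := W\<rparr>) \<and> W.lin_indpt B)"
    using maximal_exists[of "\<lambda>B. B \<subseteq> W \<and> W.lin_indpt B" V.dim "{}"] by auto
  then show ?thesis
    using W.max_li_is_gen[OF A(2)] by (auto simp: W.fin_dim_def maximal_def)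
qed

lemma fin_dim_self_space:
  assumes "field K"
  shows "vectorspace.fin_dim K (self_space K)"
proof -
  interpret V: vectorspace K "self_space K" by (rule vectorspace_self_space) fact
  have one: "{\<one>\<^bsub>K\<^esub>} \<subseteq> carrier (self_space K)" by (simp add: self_space_def)
  interpret N: submodule K "V.span {\<one>\<^bsub>K\<^esub>}" "self_space K" by (rule V.span_is_submodule) fact
  have "x \<in> V.span {\<one>\<^bsub>K\<^esub>}" if "x \<in> carrier K" for x
    using N.smult_closed[OF that, of "\<one>\<^bsub>K\<^esub>"] V.in_own_span[OF one] that by (simp add: self_space_def)
  then have "V.gen_set {\<one>\<^bsub>K\<^esub>}"
    using N.subset by (auto simp: self_space_def)
  then show ?thesis using one by (auto simp: V.fin_dim_def)
qed

text \<open>A vector of a finite direct sum is the sum of its components, and \<open>f\<close> is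
  additive. Stating this for a map \<open>f\<close>, and not only for \<open>f\<close> the identity
  on \<open>dsum_space I M\<close>, lets it also serve records with the same elements as the direct
  sum and for coordinate functions.\<close>

lemma module_hom_dsum_space_expand:
  assumes "finite I" and vs: "\<And>i. i \<in> I \<Longrightarrow> vectorspace K (M i)" and "vectorspace K W"
    and f: "f \<in> module_hom K (dsum_space I M) W" and u: "u \<in> carrier (dsum_space I M)"
  shows "f u = (\<Oplus>\<^bsub>W\<^esub>i\<in>I. f (dsum_inj I M i (u i)))"
proof -
  interpret W: vectorspace K W by fact
  interpret D: vectorspace K "dsum_space I M" by (intro vectorspace_dsum_space vs W.field_axioms)
  interpret f: linear_map K "dsum_space I M" W f
    by (intro linear_mapI D.vectorspace_axioms W.vectorspace_axioms f)
  have m: "abelian_monoid (M i)" if "i \<in> I" for i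
    using vs[OF that] by (auto simp: vectorspace_def module_def abelian_group_def)
  have inj: "dsum_inj I M i x \<in> carrier (dsum_space I M)" if "i \<in> I" "x \<in> carrier (M i)" for i x
    using that by (auto simp: dsum_inj_def dsum_space_def m abelian_monoid.zero_closed)
  \<comment> \<open>The statement is strengthened to vectors supported on a subset \<open>J\<close>,
    with \<open>u\<close> arbitrary, so that the induction can erase one coordinate and continue
    with the rest.\<close>
  have "f u = (\<Oplus>\<^bsub>W\<^esub>i\<in>J. f (dsum_inj I M i (u i)))"
    if "finite J" "J \<subseteq> I" "u \<in> carrier (dsum_space I M)" "\<And>i. i \<in> I - J \<Longrightarrow> u i = \<zero>\<^bsub>M i\<^esub>" for J u
    using that
  proof (induction arbitrary: u)
    case empty
    then have "u = \<zero>\<^bsub>dsum_space I M\<^esub>"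
      by (auto simp: dsum_space_def fun_eq_iff PiE_iff extensional_def)
    then show ?case by simp
  next
    case (insert j J)
    define u' where "u' = (\<lambda>i\<in>I. if i = j then \<zero>\<^bsub>M i\<^esub> else u i)"
    have ui: "u i \<in> carrier (M i)" if "i \<in> I" for i using that insert.prems by (auto simp: dsum_space_def)
    have j: "j \<in> I" using insert by auto
    have u': "u' \<in> carrier (dsum_space I M)"
      by (auto simp: u'_def dsum_space_def ui m abelian_monoid.zero_closed)
    have "u = dsum_inj I M j (u j) \<oplus>\<^bsub>dsum_space I M\<^esub> u'"
      using insert.prems(2) ui
      by (auto simp: dsum_space_def dsum_inj_def u'_def fun_eq_iff m abelian_monoid.r_zero
          abelian_monoid.l_zero PiE_iff extensional_def)
    then have "f u = f (dsum_inj I M j (u j)) \<oplus>\<^bsub>W\<^esub> f u'"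
      using inj[OF j ui[OF j]] u' by (metis f.T_add)
    also have "f u' = (\<Oplus>\<^bsub>W\<^esub>i\<in>J. f (dsum_inj I M i (u' i)))"
      using insert.prems by (intro insert.IH u') (auto simp: u'_def)
    also have "\<dots> = (\<Oplus>\<^bsub>W\<^esub>i\<in>J. f (dsum_inj I M i (u i)))"
      using insert.hyps insert.prems inj ui
      by (intro W.M.finsum_cong') (auto simp: u'_def)
    finally show ?case
      using insert.hyps insert.prems inj ui j
      by (subst W.M.finsum_insert) (auto intro!: f.T_im inj)
  qed
  from this[of I u] show ?thesis using assms by auto
qed

lemma dsum_inj_hom:
  assumes "\<And>i. i \<in> I \<Longrightarrow> vectorspace K (M i)" and "i \<in> I"
  shows "dsum_inj I M i \<in> module_hom K (M i) (dsum_space I M)"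
proof -
  have m: "abelian_monoid (M i)" "module K (M i)" if "i \<in> I" for i
    using assms(1)[OF that] by (auto simp: vectorspace_def module_def abelian_group_def)
  show ?thesis using assms(2)
    by (auto simp: module_hom_def dsum_inj_def dsum_space_def fun_eq_iff m
        abelian_monoid.zero_closed abelian_monoid.l_zero intro!: module.rmult_0[symmetric])
qed

text \<open>Finite generating sets of the summands, moved into the sum by the injections, together
  generate it, because every vector is the sum of its components.\<close>

lemma fin_dim_dsum_space:
  assumes "finite I" and vs: "\<And>i. i \<in> I \<Longrightarrow> vectorspace K (M i)"
    and fd: "\<And>i. i \<in> I \<Longrightarrow> vectorspace.fin_dim K (M i)" and "field K"
  shows "vectorspace.fin_dim K (dsum_space I M)"
proof -
  interpret D: vectorspace K "dsum_space I M" by (intro vectorspace_dsum_space vs assms)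
  have "\<exists>G. finite G \<and> G \<subseteq> carrier (M i) \<and> LinearCombinations.module.span K (M i) G = carrier (M i)"
    if "i \<in> I" for i
    using fd[OF that] vectorspace.fin_dim_def[OF vs[OF that]] by auto
  then obtain G where G: "\<And>i. i \<in> I \<Longrightarrow> finite (G i)" "\<And>i. i \<in> I \<Longrightarrow> G i \<subseteq> carrier (M i)"
    "\<And>i. i \<in> I \<Longrightarrow> LinearCombinations.module.span K (M i) (G i) = carrier (M i)"
    by metis
  have lin: "linear_map K (M i) (dsum_space I M) (dsum_inj I M i)" if "i \<in> I" for i
    by (intro linear_mapI vs that D.vectorspace_axioms dsum_inj_hom)
  define B where "B = (\<Union>i\<in>I. dsum_inj I M i ` G i)"
  have B: "B \<subseteq> carrier (dsum_space I M)"
    using G(2) mod_hom.f_im[OF linear_map.axioms(3)[OF lin]] by (auto simp: B_def)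
  have inj: "dsum_inj I M i x \<in> D.span B" if "i \<in> I" "x \<in> carrier (M i)" for i x
  proof -
    have "dsum_inj I M i x \<in> D.span (dsum_inj I M i ` G i)"
      using linear_map_image_span[OF lin G(2)] G(3) that by auto
    then show ?thesis
      using D.span_is_monotone[of "dsum_inj I M i ` G i" B] that by (auto simp: B_def)
  qed
  \<comment> \<open>With the identity map, the expansion formula becomes the decomposition of
    \<open>u\<close> itself.\<close>
  have id: "(\<lambda>x. x) \<in> module_hom K (dsum_space I M) (dsum_space I M)" by (auto simp: module_hom_def)
  have "u \<in> D.span B" if u: "u \<in> carrier (dsum_space I M)" for u
  proof -
    have "u = (\<Oplus>\<^bsub>dsum_space I M\<^esub>i\<in>I. dsum_inj I M i (u i))"
      using module_hom_dsum_space_expand[OF assms(1) vs D.vectorspace_axioms id u] by simp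
    also have "\<dots> \<in> D.span B"
      by (intro submodule_finsum_closed[OF D.span_is_submodule[OF B]] Pi_I inj)
        (use u in \<open>auto simp: dsum_space_def\<close>)
    finally show ?thesis .
  qed
  then have "D.gen_set B" using D.span_is_subset2[OF B] by auto
  moreover have "finite B" using G(1) assms(1) by (auto simp: B_def)
  ultimately show ?thesis using B by (auto simp: D.fin_dim_def)
qed

section \<open>Matrix and incidence algebras\<close>

lemma mat_alg_simps:
  "carrier (mat_alg K P) = carrier P \<times> carrier P \<rightarrow>\<^sub>E carrier K"
  "M \<otimes>\<^bsub>mat_alg K P\<^esub> N = (\<lambda>(x, z)\<in>carrier P \<times> carrier P. \<Oplus>\<^bsub>K\<^esub>y\<in>carrier P. M (x, y) \<otimes>\<^bsub>K\<^esub> N (y, z))"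
  "\<one>\<^bsub>mat_alg K P\<^esub> = (\<lambda>(x, y)\<in>carrier P \<times> carrier P. if x = y then \<one>\<^bsub>K\<^esub> else \<zero>\<^bsub>K\<^esub>)"
  "\<zero>\<^bsub>mat_alg K P\<^esub> = (\<lambda>i\<in>carrier P \<times> carrier P. \<zero>\<^bsub>K\<^esub>)"
  "M \<oplus>\<^bsub>mat_alg K P\<^esub> N = (\<lambda>i\<in>carrier P \<times> carrier P. M i \<oplus>\<^bsub>K\<^esub> N i)"
  "c \<odot>\<^bsub>mat_alg K P\<^esub> M = (\<lambda>i\<in>carrier P \<times> carrier P. c \<otimes>\<^bsub>K\<^esub> M i)"
  by (simp_all add: mat_alg_def Let_def)

lemma incidence_simps [simp]:
  "monoid.mult (incidence K P) = monoid.mult (mat_alg K P)"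
  "\<one>\<^bsub>incidence K P\<^esub> = \<one>\<^bsub>mat_alg K P\<^esub>"
  "\<zero>\<^bsub>incidence K P\<^esub> = \<zero>\<^bsub>mat_alg K P\<^esub>"
  "add (incidence K P) = add (mat_alg K P)"
  "smult (incidence K P) = smult (mat_alg K P)"
  by (simp_all add: incidence_def)

text \<open>Forgetting multiplication, a matrix is a family of scalars indexed by pairs: the space
  is a direct sum of copies of the field.\<close>

lemma vectorspace_mat_alg:
  assumes "field K"
  shows "vectorspace K (mat_alg K P)"
proof -
  interpret field K by fact
  show ?thesis
    by (rule vectorspace_transfer[where T = "\<lambda>x. x",
          OF vectorspace_dsum_space[OF assms vectorspace_self_space[OF assms],
            where I = "carrier P \<times> carrier P"]])
      (auto simp: mat_alg_simps dsum_space_def self_space_def)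
qed

lemma ring_mat_alg:
  assumes "field K" and fin: "finite (carrier P)"
  shows "ring (mat_alg K P)"
proof -
  interpret field K by fact
  interpret A: vectorspace K "mat_alg K P" by (rule vectorspace_mat_alg) fact
  let ?I = "carrier P"
  have mem: "M (x, y) \<in> carrier K" if "M \<in> carrier (mat_alg K P)" "x \<in> ?I" "y \<in> ?I" for M x y
    using that by (auto simp: mat_alg_simps)
  have closed: "M \<otimes>\<^bsub>mat_alg K P\<^esub> N \<in> carrier (mat_alg K P)"
    if "M \<in> carrier (mat_alg K P)" "N \<in> carrier (mat_alg K P)" for M N
    using that by (auto simp: mat_alg_simps intro!: finsum_closed)
  have eqI: "M = N" if "M \<in> carrier (mat_alg K P)" "N \<in> carrier (mat_alg K P)"
    "\<And>x y. x \<in> ?I \<Longrightarrow> y \<in> ?I \<Longrightarrow> M (x, y) = N (x, y)" for M N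
    by (rule PiE_ext[of _ "carrier P \<times> carrier P" "\<lambda>_. carrier K"])
      (use that in \<open>auto simp: mat_alg_simps\<close>)
  have one: "\<one>\<^bsub>mat_alg K P\<^esub> \<in> carrier (mat_alg K P)" by (auto simp: mat_alg_simps)
  have mult: "(M \<otimes>\<^bsub>mat_alg K P\<^esub> N) (x, z) = (\<Oplus>\<^bsub>K\<^esub>y\<in>?I. M (x, y) \<otimes>\<^bsub>K\<^esub> N (y, z))"
    if "x \<in> ?I" "z \<in> ?I" for M N x z
    using that by (simp add: mat_alg_simps)
  have assoc: "(M \<otimes>\<^bsub>mat_alg K P\<^esub> N) \<otimes>\<^bsub>mat_alg K P\<^esub> L = M \<otimes>\<^bsub>mat_alg K P\<^esub> (N \<otimes>\<^bsub>mat_alg K P\<^esub> L)"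
    if M: "M \<in> carrier (mat_alg K P)" and N: "N \<in> carrier (mat_alg K P)" and L: "L \<in> carrier (mat_alg K P)" for M N L
  proof (rule eqI)
    fix x w assume x: "x \<in> ?I" "w \<in> ?I"
    note mem' = mem[OF M] mem[OF N] mem[OF L]
    have "((M \<otimes>\<^bsub>mat_alg K P\<^esub> N) \<otimes>\<^bsub>mat_alg K P\<^esub> L) (x, w)
        = (\<Oplus>\<^bsub>K\<^esub>z\<in>?I. (\<Oplus>\<^bsub>K\<^esub>y\<in>?I. M (x, y) \<otimes>\<^bsub>K\<^esub> N (y, z)) \<otimes>\<^bsub>K\<^esub> L (z, w))"
      unfolding mult[OF x] by (rule finsum_cong') (auto simp: mult x mem' intro!: finsum_closed)
    also have "\<dots> = (\<Oplus>\<^bsub>K\<^esub>z\<in>?I. \<Oplus>\<^bsub>K\<^esub>y\<in>?I. M (x, y) \<otimes>\<^bsub>K\<^esub> (N (y, z) \<otimes>\<^bsub>K\<^esub> L (z, w)))"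
      by (rule finsum_cong')
        (use fin in \<open>auto simp: x mem' finsum_ldistr m_assoc intro!: finsum_cong' finsum_closed\<close>)
    \<comment> \<open>Associativity rests on exchanging the two summation indices.\<close>
    also have "\<dots> = (\<Oplus>\<^bsub>K\<^esub>y\<in>?I. \<Oplus>\<^bsub>K\<^esub>z\<in>?I. M (x, y) \<otimes>\<^bsub>K\<^esub> (N (y, z) \<otimes>\<^bsub>K\<^esub> L (z, w)))"
      by (rule finsum_finsum_swap) (auto simp: fin x mem')
    also have "\<dots> = (M \<otimes>\<^bsub>mat_alg K P\<^esub> (N \<otimes>\<^bsub>mat_alg K P\<^esub> L)) (x, w)"
      unfolding mult[OF x]
      by (rule finsum_cong') (use fin in \<open>auto simp: mult x mem' finsum_rdistr intro!: finsum_closed\<close>)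
    finally show "((M \<otimes>\<^bsub>mat_alg K P\<^esub> N) \<otimes>\<^bsub>mat_alg K P\<^esub> L) (x, w)
        = (M \<otimes>\<^bsub>mat_alg K P\<^esub> (N \<otimes>\<^bsub>mat_alg K P\<^esub> L)) (x, w)" .
  qed (intro closed M N L)+
  have unit: "\<one>\<^bsub>mat_alg K P\<^esub> \<otimes>\<^bsub>mat_alg K P\<^esub> M = M" "M \<otimes>\<^bsub>mat_alg K P\<^esub> \<one>\<^bsub>mat_alg K P\<^esub> = M"
    if M: "M \<in> carrier (mat_alg K P)" for M
  proof (safe intro!: eqI closed one M)
    fix x z assume x: "x \<in> ?I" "z \<in> ?I"
    have "(\<one>\<^bsub>mat_alg K P\<^esub> \<otimes>\<^bsub>mat_alg K P\<^esub> M) (x, z) = (\<Oplus>\<^bsub>K\<^esub>y\<in>?I. if x = y then M (y, z) else \<zero>\<^bsub>K\<^esub>)"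
      unfolding mult[OF x] by (rule finsum_cong') (auto simp: mat_alg_simps(3) x mem[OF M])
    also have "\<dots> = M (x, z)" by (rule finsum_singleton) (auto simp: fin x mem[OF M])
    finally show "(\<one>\<^bsub>mat_alg K P\<^esub> \<otimes>\<^bsub>mat_alg K P\<^esub> M) (x, z) = M (x, z)" .
    have "(M \<otimes>\<^bsub>mat_alg K P\<^esub> \<one>\<^bsub>mat_alg K P\<^esub>) (x, z) = (\<Oplus>\<^bsub>K\<^esub>y\<in>?I. if z = y then M (x, y) else \<zero>\<^bsub>K\<^esub>)"
      unfolding mult[OF x] by (rule finsum_cong') (auto simp: mat_alg_simps(3) x mem[OF M])
    also have "\<dots> = M (x, z)" by (rule finsum_singleton) (auto simp: fin x mem[OF M])
    finally show "(M \<otimes>\<^bsub>mat_alg K P\<^esub> \<one>\<^bsub>mat_alg K P\<^esub>) (x, z) = M (x, z)" .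
  qed
  show ?thesis
  proof (rule ringI)
    show "abelian_group (mat_alg K P)" by (rule A.M.abelian_group_axioms)
    show "monoid (mat_alg K P)" by (rule monoidI) (simp_all add: closed one assoc unit)
  next
    fix M N L assume M: "M \<in> carrier (mat_alg K P)" and N: "N \<in> carrier (mat_alg K P)" and L: "L \<in> carrier (mat_alg K P)"
    note mem' = mem[OF M] mem[OF N] mem[OF L]
    show "(M \<oplus>\<^bsub>mat_alg K P\<^esub> N) \<otimes>\<^bsub>mat_alg K P\<^esub> L = M \<otimes>\<^bsub>mat_alg K P\<^esub> L \<oplus>\<^bsub>mat_alg K P\<^esub> N \<otimes>\<^bsub>mat_alg K P\<^esub> L"
    proof (intro eqI closed A.M.a_closed M N L)
      fix x z assume x: "x \<in> ?I" "z \<in> ?I"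
      have "((M \<oplus>\<^bsub>mat_alg K P\<^esub> N) \<otimes>\<^bsub>mat_alg K P\<^esub> L) (x, z)
          = (\<Oplus>\<^bsub>K\<^esub>y\<in>?I. M (x, y) \<otimes>\<^bsub>K\<^esub> L (y, z) \<oplus>\<^bsub>K\<^esub> N (x, y) \<otimes>\<^bsub>K\<^esub> L (y, z))"
        unfolding mult[OF x] by (rule finsum_cong') (auto simp: mat_alg_simps(5) x mem' l_distr)
      then show "((M \<oplus>\<^bsub>mat_alg K P\<^esub> N) \<otimes>\<^bsub>mat_alg K P\<^esub> L) (x, z)
          = (M \<otimes>\<^bsub>mat_alg K P\<^esub> L \<oplus>\<^bsub>mat_alg K P\<^esub> N \<otimes>\<^bsub>mat_alg K P\<^esub> L) (x, z)"
        by (subst (asm) finsum_addf) (auto simp: mat_alg_simps x mem')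
    qed
    show "L \<otimes>\<^bsub>mat_alg K P\<^esub> (M \<oplus>\<^bsub>mat_alg K P\<^esub> N) = L \<otimes>\<^bsub>mat_alg K P\<^esub> M \<oplus>\<^bsub>mat_alg K P\<^esub> L \<otimes>\<^bsub>mat_alg K P\<^esub> N"
    proof (intro eqI closed A.M.a_closed M N L)
      fix x z assume x: "x \<in> ?I" "z \<in> ?I"
      have "(L \<otimes>\<^bsub>mat_alg K P\<^esub> (M \<oplus>\<^bsub>mat_alg K P\<^esub> N)) (x, z)
          = (\<Oplus>\<^bsub>K\<^esub>y\<in>?I. L (x, y) \<otimes>\<^bsub>K\<^esub> M (y, z) \<oplus>\<^bsub>K\<^esub> L (x, y) \<otimes>\<^bsub>K\<^esub> N (y, z))"
        unfolding mult[OF x] by (rule finsum_cong') (auto simp: mat_alg_simps(5) x mem' r_distr)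
      then show "(L \<otimes>\<^bsub>mat_alg K P\<^esub> (M \<oplus>\<^bsub>mat_alg K P\<^esub> N)) (x, z)
          = (L \<otimes>\<^bsub>mat_alg K P\<^esub> M \<oplus>\<^bsub>mat_alg K P\<^esub> L \<otimes>\<^bsub>mat_alg K P\<^esub> N) (x, z)"
        by (subst (asm) finsum_addf) (auto simp: mat_alg_simps x mem')
    qed
  qed
qed

text \<open>The identity function is linear from the direct sum of copies of the field to the matrix
  space, and the injection of the component i is a multiple of the matrix unit at i.\<close>

lemma mat_alg_expand:
  assumes "field K" "finite (carrier P)" "M \<in> carrier (mat_alg K P)"
  shows "M = (\<Oplus>\<^bsub>mat_alg K P\<^esub>i\<in>carrier P \<times> carrier P. M i \<odot>\<^bsub>mat_alg K P\<^esub> mat_unit K P (fst i) (snd i))"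
proof -
  interpret field K by fact
  interpret A: vectorspace K "mat_alg K P" by (rule vectorspace_mat_alg) fact
  let ?D = "dsum_space (carrier P \<times> carrier P) (\<lambda>_. self_space K)"
  have "(\<lambda>M. M) \<in> module_hom K ?D (mat_alg K P)"
    by (auto simp: module_hom_def dsum_space_def self_space_def mat_alg_simps)
  moreover have "M \<in> carrier ?D" using assms(3) by (simp add: dsum_space_def self_space_def mat_alg_simps)
  ultimately have "M = (\<Oplus>\<^bsub>mat_alg K P\<^esub>i\<in>carrier P \<times> carrier P. dsum_inj (carrier P \<times> carrier P) (\<lambda>_. self_space K) i (M i))"
    using assms vectorspace_self_space[OF assms(1)] A.vectorspace_axioms
    by (intro module_hom_dsum_space_expand[where f = "\<lambda>M. M" and K = K]) auto
  also have "\<dots> = (\<Oplus>\<^bsub>mat_alg K P\<^esub>i\<in>carrier P \<times> carrier P. M i \<odot>\<^bsub>mat_alg K P\<^esub> mat_unit K P (fst i) (snd i))"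
    using assms(3)
    by (intro A.M.finsum_cong')
      (auto simp: mat_alg_simps dsum_inj_def self_space_def mat_unit_def fun_eq_iff PiE_iff split: if_splits)
  finally show ?thesis .
qed

text \<open>This replaces the span by a zero pattern, on which membership can be tested entrywise.
  The pattern is a submodule containing the generating matrix units; conversely, in the expansion of
  a matrix of this pattern, the units outside the generating set have coefficient zero.\<close>

lemma carrier_incidence:
  assumes "field K" and fin: "finite (carrier P)"
  shows "carrier (incidence K P) = {M \<in> carrier (mat_alg K P).
    \<forall>x\<in>carrier P. \<forall>y\<in>carrier P. \<not> y \<sqsubseteq>\<^bsub>P\<^esub> x \<longrightarrow> M (x, y) = \<zero>\<^bsub>K\<^esub>}" (is "_ = ?N")
proof -
  interpret field K by fact
  interpret A: vectorspace K "mat_alg K P" by (rule vectorspace_mat_alg) fact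
  let ?G = "{mat_unit K P b a | a b. a \<in> carrier P \<and> b \<in> carrier P \<and> a \<sqsubseteq>\<^bsub>P\<^esub> b}"
  have unit: "mat_unit K P x y \<in> carrier (mat_alg K P)" for x y
    by (auto simp: mat_unit_def mat_alg_simps)
  have N: "submodule K ?N (mat_alg K P)"
    by unfold_locales (auto simp: mat_alg_simps)
  have "?G \<subseteq> ?N" using unit by (auto simp: mat_unit_def)
  then have "A.span ?G \<subseteq> ?N" by (rule A.span_is_subset[OF _ N])
  moreover have "?N \<subseteq> A.span ?G"
  proof
    fix M assume M: "M \<in> ?N"
    have G: "?G \<subseteq> carrier (mat_alg K P)" using unit by auto
    interpret G: submodule K "A.span ?G" "mat_alg K P" by (rule A.span_is_submodule[OF G])
    have "M (x, y) \<odot>\<^bsub>mat_alg K P\<^esub> mat_unit K P x y \<in> A.span ?G"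
      if xy: "x \<in> carrier P" "y \<in> carrier P" for x y
    proof (cases "y \<sqsubseteq>\<^bsub>P\<^esub> x")
      case True
      then have "mat_unit K P x y \<in> A.span ?G" using A.in_own_span[OF G] xy by blast
      then show ?thesis using M xy by (intro G.smult_closed) (auto simp: mat_alg_simps)
    qed (use M xy unit in \<open>simp add: A.lmult_0\<close>)
    then show "M \<in> A.span ?G"
      using M by (subst mat_alg_expand[OF assms, of M])
        (auto intro!: submodule_finsum_closed[OF G.submodule_axioms])
  qed
  ultimately show ?thesis by (simp add: incidence_def)
qed

lemma vectorspace_incidence:
  assumes "field K" and "finite (carrier P)"
  shows "vectorspace K (incidence K P)"
proof -
  interpret field K by fact
  interpret A: vectorspace K "mat_alg K P" by (rule vectorspace_mat_alg) fact
  show ?thesis unfolding incidence_def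
    by (intro A.subspace_is_vs A.span_is_subspace) (auto simp: mat_unit_def mat_alg_simps split: if_splits)
qed

text \<open>In the (x, z) entry of a product, a summand with both factors nonzero gives z \<le> y
  \<le> x, so transitivity preserves the zero pattern. Reflexivity puts the identity matrix into
  it.\<close>

lemma ring_incidence:
  assumes "field K" and fin: "finite (carrier P)"
    and refl: "\<And>x. x \<in> carrier P \<Longrightarrow> x \<sqsubseteq>\<^bsub>P\<^esub> x"
    and trans: "\<And>x y z. x \<in> carrier P \<Longrightarrow> y \<in> carrier P \<Longrightarrow> z \<in> carrier P \<Longrightarrow>
      x \<sqsubseteq>\<^bsub>P\<^esub> y \<Longrightarrow> y \<sqsubseteq>\<^bsub>P\<^esub> z \<Longrightarrow> x \<sqsubseteq>\<^bsub>P\<^esub> z"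
  shows "ring (incidence K P)"
proof -
  interpret field K by fact
  interpret A: ring "mat_alg K P" by (rule ring_mat_alg) fact+
  interpret V: vectorspace K "mat_alg K P" by (rule vectorspace_mat_alg) fact
  note N = carrier_incidence[OF assms(1,2)]
  \<comment> \<open>The negative in the matrix ring is given abstractly as an additive inverse; as a
    scalar multiple its entries become visible, and closure under it can be checked.\<close>
  have neg: "\<ominus>\<^bsub>mat_alg K P\<^esub> M = (\<ominus>\<^bsub>K\<^esub> \<one>\<^bsub>K\<^esub>) \<odot>\<^bsub>mat_alg K P\<^esub> M" if "M \<in> carrier (mat_alg K P)" for M
    using V.smult_minus_1[OF that] by simp
  have "subring (carrier (incidence K P)) (mat_alg K P)"
  proof (rule A.subringI)
    fix M L assume M: "M \<in> carrier (incidence K P)" and L: "L \<in> carrier (incidence K P)"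
    have "(M \<otimes>\<^bsub>mat_alg K P\<^esub> L) (x, z) = \<zero>\<^bsub>K\<^esub>"
      if "x \<in> carrier P" "z \<in> carrier P" "\<not> z \<sqsubseteq>\<^bsub>P\<^esub> x" for x z
    proof -
      have "M (x, y) \<otimes>\<^bsub>K\<^esub> L (y, z) = \<zero>\<^bsub>K\<^esub>" if y: "y \<in> carrier P" for y
      proof -
        have "M (x, y) \<in> carrier K" "L (y, z) \<in> carrier K"
          using M L that \<open>x \<in> carrier P\<close> \<open>z \<in> carrier P\<close> by (auto simp: N mat_alg_simps)
        moreover have "M (x, y) = \<zero>\<^bsub>K\<^esub> \<or> L (y, z) = \<zero>\<^bsub>K\<^esub>"
          using M L y \<open>x \<in> carrier P\<close> \<open>z \<in> carrier P\<close> \<open>\<not> z \<sqsubseteq>\<^bsub>P\<^esub> x\<close> trans[of z y x]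
          by (auto simp: N)
        ultimately show ?thesis by auto
      qed
      then show ?thesis using that by (simp add: mat_alg_simps)
    qed
    then show "M \<otimes>\<^bsub>mat_alg K P\<^esub> L \<in> carrier (incidence K P)"
      using M L by (simp add: N)
  qed (auto simp: N neg, auto simp: mat_alg_simps refl)
  then show ?thesis using A.subring_is_ring by (fastforce simp: incidence_def)
qed

section \<open>Spaces over a poset\<close>

lemma poset_spaceD:
  assumes "poset_space K P V"
  shows "vectorspace K (amb V)" "vectorspace.fin_dim K (amb V)"
    "\<And>s. s \<in> carrier P \<Longrightarrow> subspace K (sub V s) (amb V)"
    "\<And>s. s \<in> carrier P \<Longrightarrow> submodule K (sub V s) (amb V)"
    "\<And>s. s \<in> carrier P \<Longrightarrow> sub V s \<subseteq> carrier (amb V)"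
    "\<And>s t. s \<in> carrier P \<Longrightarrow> t \<in> carrier P \<Longrightarrow> s \<sqsubseteq>\<^bsub>P\<^esub> t \<Longrightarrow> sub V s \<subseteq> sub V t"
  using assms by (auto simp: poset_space_def subspace_def dest: submodule.subset)

lemma sp_homD:
  assumes "f \<in> sp_hom K P U V"
  shows "f \<in> module_hom K (amb U) (amb V)" "f \<in> extensional (carrier (amb U))"
    "\<And>s u. s \<in> carrier P \<Longrightarrow> u \<in> sub U s \<Longrightarrow> f u \<in> sub V s"
    "\<And>u. u \<in> carrier (amb U) \<Longrightarrow> f u \<in> carrier (amb V)"
  using assms by (auto simp: sp_hom_def lin_maps_def module_hom_def image_subset_iff)

lemma sp_homI:
  assumes "f \<in> module_hom K (amb U) (amb V)" "f \<in> extensional (carrier (amb U))"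
    "\<And>s u. s \<in> carrier P \<Longrightarrow> u \<in> sub U s \<Longrightarrow> f u \<in> sub V s"
  shows "f \<in> sp_hom K P U V"
  using assms by (auto simp: sp_hom_def lin_maps_def)

lemma linear_map_sp_hom:
  assumes "poset_space K P U" "poset_space K P V" "f \<in> sp_hom K P U V"
  shows "linear_map K (amb U) (amb V) f"
  using assms by (intro linear_mapI poset_spaceD(1) sp_homD(1))

lemma compose_sp_hom:
  assumes "poset_space K P U" "poset_space K P V" "poset_space K P W"
    and g: "g \<in> sp_hom K P V W" and f: "f \<in> sp_hom K P U V"
  shows "compose (carrier (amb U)) g f \<in> sp_hom K P U W"
proof -
  interpret f: linear_map K "amb U" "amb V" f by (rule linear_map_sp_hom) fact+
  interpret g: linear_map K "amb V" "amb W" g by (rule linear_map_sp_hom) fact+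
  have "compose (carrier (amb U)) g f \<in> module_hom K (amb U) (amb W)"
    by (auto simp: module_hom_def compose_def)
  moreover have "compose (carrier (amb U)) g f u \<in> sub W s" if "s \<in> carrier P" "u \<in> sub U s" for s u
    using that poset_spaceD(5)[OF assms(1), of s] sp_homD(3)[OF f that] sp_homD(3)[OF g]
    by (auto simp: compose_def)
  ultimately show ?thesis by (intro sp_homI) (auto simp: compose_def)
qed

lemma id_sp_hom:
  assumes "poset_space K P U"
  shows "(\<lambda>u\<in>carrier (amb U). u) \<in> sp_hom K P U U"
proof -
  interpret vectorspace K "amb U" by (rule poset_spaceD) fact
  show ?thesis using poset_spaceD(5)[OF assms] by (intro sp_homI) (auto simp: module_hom_def)
qed

lemma hom_space_simps [simp]:
  "carrier (hom_space K P U V) = sp_hom K P U V"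
  "\<zero>\<^bsub>hom_space K P U V\<^esub> = (\<lambda>x\<in>carrier (amb U). \<zero>\<^bsub>amb V\<^esub>)"
  "f \<oplus>\<^bsub>hom_space K P U V\<^esub> g = (\<lambda>x\<in>carrier (amb U). f x \<oplus>\<^bsub>amb V\<^esub> g x)"
  "c \<odot>\<^bsub>hom_space K P U V\<^esub> f = (\<lambda>x\<in>carrier (amb U). c \<odot>\<^bsub>amb V\<^esub> f x)"
  by (simp_all add: hom_space_def)

text \<open>For an arbitrary index set \<open>dsum_space\<close> is the full product. A Hom-set of
  extensional maps is thus a subset of the product of copies of \<open>amb V\<close> indexed by the
  vectors of \<open>U\<close>, and only closure under the operations remains.\<close>

lemma vectorspace_hom_space:
  assumes U: "poset_space K P U" and V: "poset_space K P V"
  shows "vectorspace K (hom_space K P U V)"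
proof -
  interpret U: vectorspace K "amb U" by (rule poset_spaceD) fact
  interpret V: vectorspace K "amb V" by (rule poset_spaceD) fact
  let ?D = "dsum_space (carrier (amb U)) (\<lambda>_. amb V)"
  have D: "vectorspace K ?D" by (intro vectorspace_dsum_space V.vectorspace_axioms U.field_axioms)
  note subs = submodule.zero_closed submodule.m_closed submodule.smult_closed
  have "\<zero>\<^bsub>hom_space K P U V\<^esub> \<in> sp_hom K P U V"
    using poset_spaceD(5)[OF U] subs[OF poset_spaceD(4)[OF V]]
    by (intro sp_homI) (auto simp: module_hom_def)
  moreover have "f \<oplus>\<^bsub>hom_space K P U V\<^esub> g \<in> sp_hom K P U V"
    if f: "f \<in> sp_hom K P U V" and g: "g \<in> sp_hom K P U V" for f g
  proof -
    interpret f: linear_map K "amb U" "amb V" f by (rule linear_map_sp_hom) fact+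
    interpret g: linear_map K "amb U" "amb V" g by (rule linear_map_sp_hom) fact+
    show ?thesis
      using poset_spaceD(5)[OF U] subs[OF poset_spaceD(4)[OF V]] sp_homD(3)[OF f] sp_homD(3)[OF g]
      by (intro sp_homI) (auto simp: module_hom_def V.M.a_ac V.smult_r_distr subset_iff)
  qed
  moreover have "c \<odot>\<^bsub>hom_space K P U V\<^esub> f \<in> sp_hom K P U V"
    if f: "f \<in> sp_hom K P U V" and c: "c \<in> carrier K" for c f
  proof -
    interpret f: linear_map K "amb U" "amb V" f by (rule linear_map_sp_hom) fact+
    show ?thesis
      using poset_spaceD(5)[OF U] subs[OF poset_spaceD(4)[OF V]] sp_homD(3)[OF f] c
      by (intro sp_homI)
        (auto simp: module_hom_def V.smult_r_distr V.smult_assoc1[symmetric] U.m_comm subset_iff)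
  qed
  moreover have "f \<in> carrier ?D" if "f \<in> sp_hom K P U V" for f
    using sp_homD(2,4)[OF that] by (auto simp: dsum_space_def PiE_iff)
  ultimately show ?thesis
    by (intro vectorspace_transfer[OF D, where T = "\<lambda>f. f"]) (auto simp: dsum_space_def)
qed

lemma poset_space_dsum_sp:
  assumes "finite I" "field K" and X: "\<And>i. i \<in> I \<Longrightarrow> poset_space K P (X i)"
  shows "poset_space K P (dsum_sp I X)"
proof -
  note D = poset_spaceD[OF X]
  have vs: "vectorspace K (dsum_space I (\<lambda>i. amb (X i)))"
    by (intro vectorspace_dsum_space D assms)
  have "subspace K (\<Pi>\<^sub>E i\<in>I. sub (X i) s) (dsum_space I (\<lambda>i. amb (X i)))" if s: "s \<in> carrier P" for s
  proof -
    have "submodule K (\<Pi>\<^sub>E i\<in>I. sub (X i) s) (dsum_space I (\<lambda>i. amb (X i)))"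
      using vs D(5)[OF _ s] submodule.zero_closed[OF D(4)[OF _ s]]
        submodule.m_closed[OF D(4)[OF _ s]] submodule.smult_closed[OF D(4)[OF _ s]]
      by (intro submodule.intro) (auto simp: dsum_space_def vectorspace_def PiE_iff subset_iff)
    then show ?thesis using vs by (simp add: subspace_def)
  qed
  moreover have "(\<Pi>\<^sub>E i\<in>I. sub (X i) s) \<subseteq> (\<Pi>\<^sub>E i\<in>I. sub (X i) t)"
    if "s \<in> carrier P" "t \<in> carrier P" "s \<sqsubseteq>\<^bsub>P\<^esub> t" for s t
    using D(6)[OF _ that] by (intro PiE_mono) auto
  ultimately show ?thesis
    using vs fin_dim_dsum_space[OF assms(1) D(1,2) assms(2)]
    by (simp add: poset_space_def dsum_sp_def)
qed

section \<open>The antichain poset and the spaces \<open>kA\<close>\<close>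

locale field_and_finite_poset =
  fixes K :: "('k, 'z) ring_scheme" and S :: "'s gorder"
  assumes field_K: "field K" and order_S: "partial_order S" and finite_S: "finite (carrier S)"
begin

sublocale K: field K by (rule field_K)
sublocale S: partial_order S by (rule order_S)

abbreviation "I \<equiv> carrier (Ahat S)"
abbreviation "U \<equiv> Usp K S"
abbreviation "e A \<equiv> Uinj K S A \<one>\<^bsub>K\<^esub>"

lemma finite_Ahat: "finite I"
  by (rule finite_subset[of _ "Pow (carrier S)"]) (auto simp: Ahat_def finite_S)

lemma Ahat_subset: "A \<in> I \<Longrightarrow> a \<in> A \<Longrightarrow> a \<in> carrier S"
  by (auto simp: Ahat_def)

lemma empty_Ahat: "{} \<in> I"
  by (simp add: Ahat_def)

lemma Ahat_le: "A \<sqsubseteq>\<^bsub>Ahat S\<^esub> B \<longleftrightarrow> (\<forall>b\<in>B. \<exists>a\<in>A. a \<sqsubseteq>\<^bsub>S\<^esub> b)"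
  by (simp add: Ahat_def)

lemma Ahat_refl: "A \<in> I \<Longrightarrow> A \<sqsubseteq>\<^bsub>Ahat S\<^esub> A"
  using Ahat_subset S.le_refl unfolding Ahat_le by blast

lemma Ahat_trans:
  assumes "A \<in> I" "B \<in> I" "C \<in> I" "A \<sqsubseteq>\<^bsub>Ahat S\<^esub> B" "B \<sqsubseteq>\<^bsub>Ahat S\<^esub> C"
  shows "A \<sqsubseteq>\<^bsub>Ahat S\<^esub> C"
  using assms Ahat_subset unfolding Ahat_le by (meson S.le_trans)

lemma poset_space_kA:
  assumes A: "A \<in> I"
  shows "poset_space K S (kA K S A)"
proof -
  interpret V: vectorspace K "self_space K" by (rule vectorspace_self_space) (rule field_K)
  have "submodule K (carrier K) (self_space K)" "submodule K {\<zero>\<^bsub>K\<^esub>} (self_space K)"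
    using V.module_axioms by (auto simp: submodule_def self_space_def)
  then show ?thesis
    using V.vectorspace_axioms fin_dim_self_space[OF field_K] Ahat_subset[OF A] S.le_trans
    by (auto simp: poset_space_def kA_def subspace_def)
qed

lemma poset_space_Usp: "poset_space K S U"
  unfolding Usp_def by (intro poset_space_dsum_sp finite_Ahat field_K poset_space_kA)

lemma amb_Usp: "amb U = dsum_space I (\<lambda>_. self_space K)"
  by (simp add: Usp_def dsum_sp_def kA_def)

lemma Usp_simps:
  "carrier (amb U) = (I \<rightarrow>\<^sub>E carrier K)"
  "sub U s = (\<Pi>\<^sub>E A\<in>I. if \<exists>a\<in>A. a \<sqsubseteq>\<^bsub>S\<^esub> s then carrier K else {\<zero>\<^bsub>K\<^esub>})"
  by (simp_all add: Usp_def dsum_sp_def kA_def dsum_space_def self_space_def)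

lemma Uinj_eq: "Uinj K S A x = (\<lambda>B\<in>I. if B = A then x else \<zero>\<^bsub>K\<^esub>)"
  by (simp add: Uinj_def dsum_inj_def kA_def self_space_def cong: if_cong)

lemma e_carrier: "e A \<in> carrier (amb U)"
  by (auto simp: Uinj_eq Usp_simps)

lemma e_sub:
  assumes "A \<in> I" "a \<in> A"
  shows "e A \<in> sub U a"
  using S.le_refl[OF Ahat_subset[OF assms]] assms(2) by (auto simp: Uinj_eq Usp_simps)

lemma submodule_meet:
  assumes V: "poset_space K S V" and A: "A \<subseteq> carrier S"
  shows "submodule K (carrier (meet_space V A)) (amb V)"
proof -
  interpret V: vectorspace K "amb V" by (rule poset_spaceD) fact
  have "submodule K (sub V a) (amb V)" if "a \<in> A" for a
    using poset_spaceD(4)[OF V] A that by auto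
  note subs = submodule.zero_closed[OF this] submodule.m_closed[OF this] submodule.smult_closed[OF this]
  show ?thesis by unfold_locales (auto simp: meet_space_def subs)
qed

lemma meet_space_simps [simp]:
  "\<zero>\<^bsub>meet_space V A\<^esub> = \<zero>\<^bsub>amb V\<^esub>" "add (meet_space V A) = add (amb V)"
  "smult (meet_space V A) = smult (amb V)"
  by (simp_all add: meet_space_def)

lemma carrier_meet_space: "carrier (meet_space V A) = {v \<in> carrier (amb V). \<forall>a\<in>A. v \<in> sub V a}"
  by (simp add: meet_space_def)

lemma meet_space:
  assumes V: "poset_space K S V" and A: "A \<subseteq> carrier S"
  shows "vectorspace K (meet_space V A)" "vectorspace.fin_dim K (meet_space V A)"
proof -
  interpret V: vectorspace K "amb V" by (rule poset_spaceD) fact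
  have "subspace K (carrier (meet_space V A)) (amb V)"
    using submodule_meet[OF assms] V.vectorspace_axioms by (simp add: subspace_def)
  then have "vectorspace K ((amb V)\<lparr>carrier := carrier (meet_space V A)\<rparr>)"
    "vectorspace.fin_dim K ((amb V)\<lparr>carrier := carrier (meet_space V A)\<rparr>)"
    using V.subspace_is_vs fin_dim_subspace[OF poset_spaceD(2)[OF V]] by blast+
  then show "vectorspace K (meet_space V A)" "vectorspace.fin_dim K (meet_space V A)"
    by (simp_all add: meet_space_def)
qed

text \<open>Linearity gives f x = x f(1), so all conditions concern f(1) alone. The condition at s
  is empty unless s lies above some a in \<open>A\<close>, and then it follows from the one at a
  because the subspaces of \<open>V\<close> increase.\<close>

lemma sp_hom_kA_iff:
  assumes V: "poset_space K S V" and A: "A \<in> I"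
    and f: "f \<in> lin_maps K (self_space K) (amb V)"
  shows "f \<in> sp_hom K S (kA K S A) V \<longleftrightarrow> f \<one>\<^bsub>K\<^esub> \<in> carrier (meet_space V A)"
proof -
  interpret V: vectorspace K "amb V" by (rule poset_spaceD) fact
  interpret f: linear_map K "self_space K" "amb V" f
    using f by (intro linear_mapI vectorspace_self_space field_K V.vectorspace_axioms) (simp add: lin_maps_def)
  have f0: "f \<zero>\<^bsub>K\<^esub> = \<zero>\<^bsub>amb V\<^esub>" using f.T0_is_0 by (simp add: self_space_def)
  have f1: "f x = x \<odot>\<^bsub>amb V\<^esub> f \<one>\<^bsub>K\<^esub>" if "x \<in> carrier K" for x
    using f.T_smult[of x "\<one>\<^bsub>K\<^esub>"] that by (simp add: self_space_def)
  have f1c: "f \<one>\<^bsub>K\<^esub> \<in> carrier (amb V)" using f.T_im[of "\<one>\<^bsub>K\<^esub>"] by (simp add: self_space_def)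
  have "f \<in> sp_hom K S (kA K S A) V \<longleftrightarrow>
      (\<forall>s\<in>carrier S. (\<exists>a\<in>A. a \<sqsubseteq>\<^bsub>S\<^esub> s) \<longrightarrow> (\<forall>x\<in>carrier K. f x \<in> sub V s))"
    using f submodule.zero_closed[OF poset_spaceD(4)[OF V]]
    by (auto simp: sp_hom_def kA_def f0)
  also have "\<dots> \<longleftrightarrow> (\<forall>a\<in>A. f \<one>\<^bsub>K\<^esub> \<in> sub V a)"
  proof safe
    fix a assume "a \<in> A" "\<forall>s\<in>carrier S. (\<exists>a\<in>A. a \<sqsubseteq>\<^bsub>S\<^esub> s) \<longrightarrow> (\<forall>x\<in>carrier K. f x \<in> sub V s)"
    then show "f \<one>\<^bsub>K\<^esub> \<in> sub V a" using Ahat_subset[OF A] by (meson S.le_refl K.one_closed)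
  next
    fix s a x assume *: "\<forall>a\<in>A. f \<one>\<^bsub>K\<^esub> \<in> sub V a" "s \<in> carrier S" "a \<in> A" "a \<sqsubseteq>\<^bsub>S\<^esub> s" "x \<in> carrier K"
    then have "f \<one>\<^bsub>K\<^esub> \<in> sub V s" using poset_spaceD(6)[OF V Ahat_subset[OF A], of a s] by auto
    then show "f x \<in> sub V s"
      unfolding f1[OF *(5)] using * by (intro submodule.smult_closed[OF poset_spaceD(4)[OF V]])
  qed
  finally show ?thesis by (simp add: carrier_meet_space f1c)
qed

lemma vs_iso_kA:
  assumes V: "poset_space K S V" and A: "A \<in> I"
  shows "vs_iso K (hom_space K S (kA K S A) V) (meet_space V A) (\<lambda>f. f \<one>\<^bsub>K\<^esub>)"
proof -
  interpret V: vectorspace K "amb V" by (rule poset_spaceD) fact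
  have AS: "A \<subseteq> carrier S" using Ahat_subset[OF A] by auto
  have ambA: "amb (kA K S A) = self_space K" by (simp add: kA_def)
  have lin: "f \<in> lin_maps K (self_space K) (amb V)" if "f \<in> sp_hom K S (kA K S A) V" for f
    using that by (simp add: sp_hom_def ambA)
  have f1: "f x = x \<odot>\<^bsub>amb V\<^esub> f \<one>\<^bsub>K\<^esub>" if "f \<in> sp_hom K S (kA K S A) V" "x \<in> carrier K" for f x
    using module_hom_smult[OF sp_homD(1)[OF that(1)], of x "\<one>\<^bsub>K\<^esub>"] that
    by (simp add: self_space_def ambA)
  have "(\<lambda>f. f \<one>\<^bsub>K\<^esub>) \<in> module_hom K (hom_space K S (kA K S A) V) (meet_space V A)"
    using sp_hom_kA_iff[OF V A lin] by (auto simp: module_hom_def ambA) (auto simp: self_space_def)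
  moreover have "bij_betw (\<lambda>f. f \<one>\<^bsub>K\<^esub>) (sp_hom K S (kA K S A) V) (carrier (meet_space V A))"
  proof (rule bij_betwI[where g = "\<lambda>v. \<lambda>x\<in>carrier K. x \<odot>\<^bsub>amb V\<^esub> v"])
    show "(\<lambda>f. f \<one>\<^bsub>K\<^esub>) \<in> sp_hom K S (kA K S A) V \<rightarrow> carrier (meet_space V A)"
      using sp_hom_kA_iff[OF V A lin] by auto
    show "(\<lambda>v. \<lambda>x\<in>carrier K. x \<odot>\<^bsub>amb V\<^esub> v) \<in> carrier (meet_space V A) \<rightarrow> sp_hom K S (kA K S A) V"
    proof
      fix v assume v: "v \<in> carrier (meet_space V A)"
      then have "v \<in> carrier (amb V)" by (simp add: carrier_meet_space)
      then have "(\<lambda>x\<in>carrier K. x \<odot>\<^bsub>amb V\<^esub> v) \<in> lin_maps K (self_space K) (amb V)"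
        by (auto simp: lin_maps_def module_hom_def self_space_def V.smult_l_distr V.smult_assoc1)
      then show "(\<lambda>x\<in>carrier K. x \<odot>\<^bsub>amb V\<^esub> v) \<in> sp_hom K S (kA K S A) V"
        using v by (simp add: sp_hom_kA_iff[OF V A]) (simp add: carrier_meet_space)
    qed
    show "(\<lambda>x\<in>carrier K. x \<odot>\<^bsub>amb V\<^esub> f \<one>\<^bsub>K\<^esub>) = f" if "f \<in> sp_hom K S (kA K S A) V" for f
      by (rule extensionalityI[of _ "carrier K"])
        (use f1[OF that, symmetric] sp_homD(2)[OF that] in \<open>auto simp: ambA self_space_def\<close>)
  qed (auto simp: carrier_meet_space)
  ultimately show ?thesis
    by (auto simp: vs_iso_def intro!: linear_mapI vectorspace_hom_space poset_space_kA V A meet_space AS)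
qed

text \<open>Evaluation at 1 turns morphisms into elements of V(A) with V = k_B. This intersection is
  the whole field iff every element of \<open>A\<close> lies above some element of \<open>B\<close>,
  and zero otherwise; linear endomorphisms of the field are the multiplications.\<close>

lemma sp_hom_kA_kA:
  assumes A: "A \<in> I" and B: "B \<in> I"
  shows "sp_hom K S (kA K S A) (kA K S B) =
    (if B \<sqsubseteq>\<^bsub>Ahat S\<^esub> A then {\<lambda>x\<in>carrier K. c \<otimes>\<^bsub>K\<^esub> x | c. c \<in> carrier K}
     else {\<lambda>x\<in>carrier K. \<zero>\<^bsub>K\<^esub>})"
proof -
  have meet: "carrier (meet_space (kA K S B) A) = (if B \<sqsubseteq>\<^bsub>Ahat S\<^esub> A then carrier K else {\<zero>\<^bsub>K\<^esub>})"
    by (auto simp: carrier_meet_space kA_def self_space_def Ahat_le)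
  have lin: "f \<in> lin_maps K (self_space K) (self_space K) \<longleftrightarrow>
      (\<exists>c\<in>carrier K. f = (\<lambda>x\<in>carrier K. c \<otimes>\<^bsub>K\<^esub> x))" for f
  proof
    assume f: "f \<in> lin_maps K (self_space K) (self_space K)"
    have f1: "f \<one>\<^bsub>K\<^esub> \<in> carrier K" using f by (auto simp: lin_maps_def module_hom_def self_space_def)
    have fx: "f x = f \<one>\<^bsub>K\<^esub> \<otimes>\<^bsub>K\<^esub> x" if x: "x \<in> carrier K" for x
    proof -
      have "f (x \<otimes>\<^bsub>K\<^esub> \<one>\<^bsub>K\<^esub>) = x \<otimes>\<^bsub>K\<^esub> f \<one>\<^bsub>K\<^esub>"
        using f x module_hom_smult[of f K "self_space K" "self_space K" x "\<one>\<^bsub>K\<^esub>"]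
        by (simp add: lin_maps_def self_space_def)
      then show ?thesis using x f1 by (simp add: K.m_comm)
    qed
    have "f = (\<lambda>x\<in>carrier K. f \<one>\<^bsub>K\<^esub> \<otimes>\<^bsub>K\<^esub> x)"
      using f by (intro extensionalityI[of _ "carrier K"]) (auto simp: lin_maps_def self_space_def fx[symmetric])
    with f1 show "\<exists>c\<in>carrier K. f = (\<lambda>x\<in>carrier K. c \<otimes>\<^bsub>K\<^esub> x)" by blast
  qed (auto simp: lin_maps_def module_hom_def self_space_def K.r_distr K.m_lcomm)
  let ?N = "carrier (meet_space (kA K S B) A)" and ?m = "\<lambda>c. \<lambda>x\<in>carrier K. c \<otimes>\<^bsub>K\<^esub> x"
  have "f \<in> sp_hom K S (kA K S A) (kA K S B) \<longleftrightarrow> (\<exists>c\<in>carrier K. f = ?m c) \<and> f \<one>\<^bsub>K\<^esub> \<in> ?N" for f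
  proof -
    have amb: "amb (kA K S C) = self_space K" for C by (simp add: kA_def)
    note iff = sp_hom_kA_iff[OF poset_space_kA[OF B] A, unfolded amb]
    have "f \<in> sp_hom K S (kA K S A) (kA K S B) \<longleftrightarrow>
        f \<in> lin_maps K (self_space K) (self_space K) \<and> f \<one>\<^bsub>K\<^esub> \<in> ?N"
      using iff[of f] by (auto simp: sp_hom_def amb)
    then show ?thesis unfolding lin .
  qed
  note iff = this
  have NK: "?N \<subseteq> carrier K" by (simp add: meet)
  have m1: "?m c \<one>\<^bsub>K\<^esub> = c" if "c \<in> carrier K" for c using that by simp
  have "sp_hom K S (kA K S A) (kA K S B) = ?m ` ?N"
  proof (intro equalityI subsetI)
    fix f assume "f \<in> sp_hom K S (kA K S A) (kA K S B)"
    then obtain c where c: "c \<in> carrier K" "f = ?m c" "f \<one>\<^bsub>K\<^esub> \<in> ?N" using iff by blast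
    then show "f \<in> ?m ` ?N" by (intro image_eqI[of _ _ c]) (simp_all only: m1)
  next
    fix f assume "f \<in> ?m ` ?N"
    then obtain c where c: "c \<in> ?N" "f = ?m c" by (rule imageE)
    then have "c \<in> carrier K" using NK by blast
    with c m1[of c] show "f \<in> sp_hom K S (kA K S A) (kA K S B)" unfolding iff by metis
  qed
  moreover have "(\<lambda>x\<in>carrier K. \<zero>\<^bsub>K\<^esub> \<otimes>\<^bsub>K\<^esub> x) = (\<lambda>x\<in>carrier K. \<zero>\<^bsub>K\<^esub>)"
    by (rule restrict_ext) simp
  ultimately show ?thesis by (auto simp: meet)
qed

section \<open>Morphisms from the sum of the \<open>k\<^sub>A\<close>\<close>

text \<open>The target is a bare vector space, so that the formula applies to morphisms of S-spaces
  and also to single coordinates of an endomorphism.\<close>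

lemma module_hom_Usp_expand:
  assumes W: "vectorspace K W" and f: "f \<in> module_hom K (amb U) W" and u: "u \<in> carrier (amb U)"
  shows "f u = (\<Oplus>\<^bsub>W\<^esub>C\<in>I. u C \<odot>\<^bsub>W\<^esub> f (e C))"
proof -
  interpret W: vectorspace K W by fact
  have fe: "f (e C) \<in> carrier W" for C using f e_carrier by (auto simp: module_hom_def)
  have "f (dsum_inj I (\<lambda>_. self_space K) C (u C)) = u C \<odot>\<^bsub>W\<^esub> f (e C)" if "C \<in> I" for C
  proof -
    have uC: "u C \<in> carrier K" using u that by (auto simp: Usp_simps)
    then have "dsum_inj I (\<lambda>_. self_space K) C (u C) = u C \<odot>\<^bsub>amb U\<^esub> e C"
      by (auto simp: amb_Usp dsum_inj_def dsum_space_def self_space_def Uinj_eq)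
    then show ?thesis using module_hom_smult[OF f uC e_carrier] by simp
  qed
  moreover have "f u = (\<Oplus>\<^bsub>W\<^esub>C\<in>I. f (dsum_inj I (\<lambda>_. self_space K) C (u C)))"
    using f u unfolding amb_Usp
    by (intro module_hom_dsum_space_expand[where K = K] W finite_Ahat vectorspace_self_space field_K)
  ultimately show ?thesis
    using u fe by (auto intro!: W.M.finsum_cong' simp: Usp_simps)
qed

text \<open>Both maps expand over the same coordinates of \<open>u\<close>. Equalities of morphisms
  out of \<open>U\<close> are from here on checked on the vectors \<open>e C\<close>.\<close>

lemma sp_hom_Usp_eqI:
  assumes V: "poset_space K S V" and f: "f \<in> sp_hom K S U V" and g: "g \<in> sp_hom K S U V"
    and eq: "\<And>C. C \<in> I \<Longrightarrow> f (e C) = g (e C)"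
  shows "f = g"
proof (rule extensionalityI[OF sp_homD(2)[OF f] sp_homD(2)[OF g]])
  interpret V: vectorspace K "amb V" by (rule poset_spaceD) fact
  fix u assume u: "u \<in> carrier (amb U)"
  show "f u = g u"
    unfolding module_hom_Usp_expand[OF poset_spaceD(1)[OF V] sp_homD(1)[OF f] u]
      module_hom_Usp_expand[OF poset_spaceD(1)[OF V] sp_homD(1)[OF g] u]
    using u sp_homD(4)[OF g e_carrier] by (intro V.M.finsum_cong') (auto simp: eq Usp_simps)
qed

lemma sp_hom_e_mem:
  assumes "f \<in> sp_hom K S U V" "C \<in> I"
  shows "f (e C) \<in> carrier (meet_space V C)"
  using sp_homD(4)[OF assms(1) e_carrier] sp_homD(3)[OF assms(1) _ e_sub] Ahat_subset assms(2)
  by (auto simp: carrier_meet_space)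

text \<open>The linear extension of the assignment sending \<open>e C\<close> to \<open>v C\<close>;
  on admissible row vectors it inverts \<open>rowvec\<close>.\<close>

definition row_hom :: "('k, 'v, 's) sspace \<Rightarrow> ('s set \<Rightarrow> 'v) \<Rightarrow> ('s set \<Rightarrow> 'k) \<Rightarrow> 'v" where
  "row_hom V v = (\<lambda>u\<in>carrier (amb U). \<Oplus>\<^bsub>amb V\<^esub>C\<in>I. u C \<odot>\<^bsub>amb V\<^esub> v C)"

text \<open>A vector of \<open>sub U s\<close> can have a nonzero coordinate at \<open>C\<close>
  only if some a in \<open>C\<close> lies below s. For such \<open>C\<close> the vector
  \<open>v C\<close> lies in V(a) and hence in V(s), so the linear extension respects the
  subspaces.\<close>

lemma row_hom:
  assumes V: "poset_space K S V" and v: "\<And>C. C \<in> I \<Longrightarrow> v C \<in> carrier (meet_space V C)"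
  shows "row_hom V v \<in> sp_hom K S U V" and "C \<in> I \<Longrightarrow> row_hom V v (e C) = v C"
proof -
  interpret V: vectorspace K "amb V" by (rule poset_spaceD) fact
  interpret U: vectorspace K "amb U" by (rule poset_spaceD) (rule poset_space_Usp)
  have vV: "v C \<in> carrier (amb V)" if "C \<in> I" for C using v[OF that] by (simp add: carrier_meet_space)
  have K: "u C \<in> carrier K" if "u \<in> carrier (amb U)" "C \<in> I" for u C using that by (auto simp: Usp_simps)
  have "row_hom V v \<in> module_hom K (amb U) (amb V)"
  proof -
    have "row_hom V v (u \<oplus>\<^bsub>amb U\<^esub> w) = row_hom V v u \<oplus>\<^bsub>amb V\<^esub> row_hom V v w"
      if u: "u \<in> carrier (amb U)" and w: "w \<in> carrier (amb U)" for u w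
    proof -
      have "(\<Oplus>\<^bsub>amb V\<^esub>C\<in>I. (u \<oplus>\<^bsub>amb U\<^esub> w) C \<odot>\<^bsub>amb V\<^esub> v C)
          = (\<Oplus>\<^bsub>amb V\<^esub>C\<in>I. u C \<odot>\<^bsub>amb V\<^esub> v C \<oplus>\<^bsub>amb V\<^esub> w C \<odot>\<^bsub>amb V\<^esub> v C)"
        by (rule V.M.finsum_cong')
          (auto simp: K[OF u] K[OF w] vV V.smult_l_distr, auto simp: amb_Usp dsum_space_def self_space_def
            K[OF u] K[OF w] vV V.smult_l_distr)
      also have "\<dots> = (\<Oplus>\<^bsub>amb V\<^esub>C\<in>I. u C \<odot>\<^bsub>amb V\<^esub> v C) \<oplus>\<^bsub>amb V\<^esub> (\<Oplus>\<^bsub>amb V\<^esub>C\<in>I. w C \<odot>\<^bsub>amb V\<^esub> v C)"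
        by (rule V.M.finsum_addf) (auto simp: K[OF u] K[OF w] vV)
      finally show ?thesis using u w by (simp add: row_hom_def)
    qed
    moreover have "row_hom V v (c \<odot>\<^bsub>amb U\<^esub> u) = c \<odot>\<^bsub>amb V\<^esub> row_hom V v u"
      if u: "u \<in> carrier (amb U)" and c: "c \<in> carrier K" for u c
    proof -
      have "(\<Oplus>\<^bsub>amb V\<^esub>C\<in>I. (c \<odot>\<^bsub>amb U\<^esub> u) C \<odot>\<^bsub>amb V\<^esub> v C)
          = (\<Oplus>\<^bsub>amb V\<^esub>C\<in>I. c \<odot>\<^bsub>amb V\<^esub> (u C \<odot>\<^bsub>amb V\<^esub> v C))"
        by (rule V.M.finsum_cong')
          (auto simp: K[OF u] c vV, auto simp: amb_Usp dsum_space_def self_space_def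
            K[OF u] vV c V.smult_assoc1)
      also have "\<dots> = c \<odot>\<^bsub>amb V\<^esub> (\<Oplus>\<^bsub>amb V\<^esub>C\<in>I. u C \<odot>\<^bsub>amb V\<^esub> v C)"
        by (rule V.finsum_smult[symmetric]) (auto simp: K[OF u] c vV)
      finally show ?thesis using u c by (simp add: row_hom_def)
    qed
    moreover have "row_hom V v u \<in> carrier (amb V)" if "u \<in> carrier (amb U)" for u
      using that K[OF that] vV by (auto simp: row_hom_def intro!: V.M.finsum_closed)
    ultimately show ?thesis by (auto simp: module_hom_def)
  qed
  moreover have "row_hom V v u \<in> sub V s" if s: "s \<in> carrier S" and u: "u \<in> sub U s" for u s
  proof -
    have uU: "u \<in> carrier (amb U)" using poset_spaceD(5)[OF poset_space_Usp s] u by auto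
    have "u C \<odot>\<^bsub>amb V\<^esub> v C \<in> sub V s" if C: "C \<in> I" for C
    proof (cases "\<exists>a\<in>C. a \<sqsubseteq>\<^bsub>S\<^esub> s")
      case True
      then have "v C \<in> sub V s"
        using v[OF C] poset_spaceD(6)[OF V Ahat_subset[OF C] s] by (auto simp: carrier_meet_space)
      then show ?thesis using K[OF uU C] submodule.smult_closed[OF poset_spaceD(4)[OF V s]] by auto
    next
      case False
      then have "u C = \<zero>\<^bsub>K\<^esub>" using u C by (auto simp: Usp_simps PiE_iff)
      then show ?thesis using vV[OF C] submodule.zero_closed[OF poset_spaceD(4)[OF V s]] by simp
    qed
    then show ?thesis
      using uU by (auto simp: row_hom_def intro!: submodule_finsum_closed[OF poset_spaceD(4)[OF V s]])
  qed
  ultimately show "row_hom V v \<in> sp_hom K S U V" by (intro sp_homI) (auto simp: row_hom_def)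
  show "row_hom V v (e C) = v C" if C: "C \<in> I"
  proof -
    have "(\<Oplus>\<^bsub>amb V\<^esub>D\<in>I. e C D \<odot>\<^bsub>amb V\<^esub> v D) = (\<Oplus>\<^bsub>amb V\<^esub>D\<in>I. if C = D then v D else \<zero>\<^bsub>amb V\<^esub>)"
      by (rule V.M.finsum_cong') (auto simp: vV Uinj_eq)
    also have "\<dots> = v C" by (rule V.M.finsum_singleton) (auto simp: finite_Ahat vV C)
    finally show ?thesis using e_carrier by (simp add: row_hom_def)
  qed
qed

lemma vs_iso_rowvec:
  assumes V: "poset_space K S V"
  shows "vs_iso K (hom_space K S U V) (dsum_space I (meet_space V)) (rowvec K S)"
proof -
  have "rowvec K S \<in> module_hom K (hom_space K S U V) (dsum_space I (meet_space V))"
    using sp_hom_e_mem e_carrier by (auto simp: module_hom_def rowvec_def dsum_space_def)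
  moreover have "bij_betw (rowvec K S) (sp_hom K S U V) (\<Pi>\<^sub>E C\<in>I. carrier (meet_space V C))"
  proof (rule bij_betwI[where g = "row_hom V"])
    show "rowvec K S \<in> sp_hom K S U V \<rightarrow> (\<Pi>\<^sub>E C\<in>I. carrier (meet_space V C))"
      using sp_hom_e_mem by (auto simp: rowvec_def)
    show "row_hom V \<in> (\<Pi>\<^sub>E C\<in>I. carrier (meet_space V C)) \<rightarrow> sp_hom K S U V"
      using row_hom(1)[OF V] by auto
    show "row_hom V (rowvec K S f) = f" if f: "f \<in> sp_hom K S U V" for f
      using sp_hom_e_mem[OF f] row_hom[OF V, of "rowvec K S f"] f
      by (intro sp_hom_Usp_eqI[OF V]) (auto simp: rowvec_def)
    show "rowvec K S (row_hom V v) = v" if "v \<in> (\<Pi>\<^sub>E C\<in>I. carrier (meet_space V C))" for v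
      using that row_hom(2)[OF V, of v] by (auto simp: rowvec_def fun_eq_iff PiE_iff extensional_def)
  qed
  moreover have "vectorspace K (dsum_space I (meet_space V))"
    using meet_space(1)[OF V] Ahat_subset by (intro vectorspace_dsum_space field_K) auto
  ultimately show ?thesis
    by (auto simp: vs_iso_def dsum_space_def intro!: linear_mapI vectorspace_hom_space poset_space_Usp V)
qed

section \<open>Endomorphisms as matrices\<close>

text \<open>Membership in \<open>sub U a\<close> leaves free the coordinates at those
  \<open>B\<close> with an element below a. Imposing this for all a in \<open>A\<close> leaves free
  exactly the \<open>B\<close> with \<open>B\<close> \<le> \<open>A\<close>.\<close>

lemma carrier_meet_space_Usp:
  assumes "A \<in> I"
  shows "carrier (meet_space U A) = {u \<in> I \<rightarrow>\<^sub>E carrier K. \<forall>B\<in>I. \<not> B \<sqsubseteq>\<^bsub>Ahat S\<^esub> A \<longrightarrow> u B = \<zero>\<^bsub>K\<^esub>}"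
  using assms by (auto simp: carrier_meet_space Usp_simps Ahat_le PiE_iff)

lemma end_mat_apply: "B \<in> I \<Longrightarrow> A \<in> I \<Longrightarrow> end_mat K S f (B, A) = f (e A) B"
  by (simp add: end_mat_def dsum_proj_def)

lemma finite_inv_Ahat: "finite (carrier (inv_gorder (Ahat S)))"
  by (simp add: finite_Ahat)

lemma carrier_incidence_inv_Ahat:
  "carrier (incidence K (inv_gorder (Ahat S))) =
    {M \<in> I \<times> I \<rightarrow>\<^sub>E carrier K. \<forall>B\<in>I. \<forall>A\<in>I. \<not> B \<sqsubseteq>\<^bsub>Ahat S\<^esub> A \<longrightarrow> M (B, A) = \<zero>\<^bsub>K\<^esub>}"
  by (simp add: carrier_incidence[OF field_K finite_inv_Ahat] mat_alg_simps)

lemma end_alg_simps [simp]: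
  "carrier (end_alg K S U) = sp_hom K S U U"
  "f \<otimes>\<^bsub>end_alg K S U\<^esub> g = compose (carrier (amb U)) f g"
  "\<one>\<^bsub>end_alg K S U\<^esub> = (\<lambda>x\<in>carrier (amb U). x)"
  "f \<oplus>\<^bsub>end_alg K S U\<^esub> g = (\<lambda>x\<in>carrier (amb U). f x \<oplus>\<^bsub>amb U\<^esub> g x)"
  "c \<odot>\<^bsub>end_alg K S U\<^esub> f = (\<lambda>x\<in>carrier (amb U). c \<odot>\<^bsub>amb U\<^esub> f x)"
  by (simp_all add: end_alg_def hom_space_def)

lemma vectorspace_end_alg: "vectorspace K (end_alg K S U)"
proof -
  interpret H: vectorspace K "hom_space K S U U"
    by (intro vectorspace_hom_space poset_space_Usp)
  have "add (end_alg K S U) = add (hom_space K S U U)" "smult (end_alg K S U) = smult (hom_space K S U U)"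
    "\<zero>\<^bsub>end_alg K S U\<^esub> = \<zero>\<^bsub>hom_space K S U U\<^esub>" "carrier (end_alg K S U) = carrier (hom_space K S U U)"
    by (simp_all add: end_alg_def)
  then show ?thesis
    by (intro vectorspace_transfer[OF H.vectorspace_axioms, where T = "\<lambda>f. f"])
      (simp_all del: hom_space_simps end_alg_simps)
qed

text \<open>This is the product of a matrix with a column, obtained by expanding the linear
  functional that takes the coordinate at \<open>B\<close>. It is what makes \<open>end_mat\<close>
  multiplicative.\<close>

lemma endomorphism_Usp_apply:
  assumes f: "f \<in> sp_hom K S U U" and u: "u \<in> carrier (amb U)" and B: "B \<in> I"
  shows "f u B = (\<Oplus>\<^bsub>K\<^esub>C\<in>I. f (e C) B \<otimes>\<^bsub>K\<^esub> u C)"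
proof -
  have "(\<lambda>u. f u B) \<in> module_hom K (amb U) (self_space K)"
    using sp_homD(1)[OF f] B by (auto simp: module_hom_def amb_Usp dsum_space_def self_space_def PiE_iff)
  then have "f u B = (\<Oplus>\<^bsub>self_space K\<^esub>C\<in>I. u C \<odot>\<^bsub>self_space K\<^esub> f (e C) B)"
    using module_hom_Usp_expand[OF vectorspace_self_space[OF field_K], of "\<lambda>u. f u B" u] u by simp
  \<comment> \<open>\<open>self_space K\<close> and \<open>K\<close> have the same carrier, zero and
    addition, and a finite sum depends on nothing else.\<close>
  also have "\<dots> = (\<Oplus>\<^bsub>K\<^esub>C\<in>I. u C \<otimes>\<^bsub>K\<^esub> f (e C) B)"
    by (simp add: finsum_def finprod_def self_space_def)
  also have "\<dots> = (\<Oplus>\<^bsub>K\<^esub>C\<in>I. f (e C) B \<otimes>\<^bsub>K\<^esub> u C)"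
    using u B sp_homD(4)[OF f e_carrier] by (intro K.finsum_cong') (auto simp: Usp_simps K.m_comm PiE_iff)
  finally show ?thesis .
qed

text \<open>Column \<open>A\<close> of the matrix is the vector \<open>f (e A)\<close>. It ranges
  over \<open>meet_space U A\<close>, which is precisely the zero pattern of column \<open>A\<close>
  in the incidence algebra; columns at different \<open>A\<close> can be chosen
  independently.\<close>

lemma alg_iso_end_mat:
  "alg_iso K (end_alg K S U) (incidence K (inv_gorder (Ahat S))) (end_mat K S)"
proof -
  let ?R = "incidence K (inv_gorder (Ahat S))"
  have eA: "f (e A) B \<in> carrier K" if "f \<in> sp_hom K S U U" "B \<in> I" for f A B
    using sp_homD(4)[OF that(1) e_carrier] that(2) by (auto simp: Usp_simps PiE_iff)
  have ext: "end_mat K S f \<in> extensional (I \<times> I)" for f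
    by (auto simp: end_mat_def)
  have R: "end_mat K S f \<in> carrier ?R" if f: "f \<in> sp_hom K S U U" for f
    using sp_hom_e_mem[OF f] eA[OF f]
    by (auto simp: carrier_incidence_inv_Ahat PiE_iff end_mat_apply ext carrier_meet_space_Usp)
  have eqI: "end_mat K S f = M"
    if "M \<in> extensional (I \<times> I)" "\<And>A B. A \<in> I \<Longrightarrow> B \<in> I \<Longrightarrow> f (e A) B = M (B, A)" for f M
    using that by (intro extensionalityI[OF ext that(1)]) (auto simp: end_mat_apply)
  have vs: "vectorspace K ?R" by (intro vectorspace_incidence field_K finite_inv_Ahat)
  have add: "end_mat K S (f \<oplus>\<^bsub>end_alg K S U\<^esub> g) = end_mat K S f \<oplus>\<^bsub>?R\<^esub> end_mat K S g"
    if "f \<in> sp_hom K S U U" "g \<in> sp_hom K S U U" for f g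
    using e_carrier
    by (intro eqI) (auto simp: mat_alg_simps end_mat_apply, simp add: amb_Usp dsum_space_def self_space_def)
  have "end_mat K S (c \<odot>\<^bsub>end_alg K S U\<^esub> f) = c \<odot>\<^bsub>?R\<^esub> end_mat K S f"
    if "c \<in> carrier K" "f \<in> sp_hom K S U U" for c f
    using e_carrier
    by (intro eqI) (auto simp: mat_alg_simps end_mat_apply, simp add: amb_Usp dsum_space_def self_space_def)
  with add R have "end_mat K S \<in> module_hom K (end_alg K S U) ?R"
    by (auto simp: module_hom_def simp del: end_alg_simps(2-) incidence_simps)
  then have lin: "linear_map K (end_alg K S U) ?R (end_mat K S)"
    by (intro linear_mapI vectorspace_end_alg vs)
  have mult: "end_mat K S (f \<otimes>\<^bsub>end_alg K S U\<^esub> g) = end_mat K S f \<otimes>\<^bsub>?R\<^esub> end_mat K S g"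
    if f: "f \<in> sp_hom K S U U" and g: "g \<in> sp_hom K S U U" for f g
  proof (rule eqI)
    fix A B assume A: "A \<in> I" and B: "B \<in> I"
    have "(f \<otimes>\<^bsub>end_alg K S U\<^esub> g) (e A) B = f (g (e A)) B" by (simp add: compose_def e_carrier)
    also have "\<dots> = (\<Oplus>\<^bsub>K\<^esub>C\<in>I. f (e C) B \<otimes>\<^bsub>K\<^esub> g (e A) C)"
      by (intro endomorphism_Usp_apply f B sp_homD(4)[OF g] e_carrier)
    also have "\<dots> = (end_mat K S f \<otimes>\<^bsub>?R\<^esub> end_mat K S g) (B, A)"
      using A B by (auto simp: mat_alg_simps end_mat_apply eA[OF f] eA[OF g] intro!: K.finsum_cong')
    finally show "(f \<otimes>\<^bsub>end_alg K S U\<^esub> g) (e A) B = (end_mat K S f \<otimes>\<^bsub>?R\<^esub> end_mat K S g) (B, A)" .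
  qed (auto simp: mat_alg_simps)
  have one: "end_mat K S \<one>\<^bsub>end_alg K S U\<^esub> = \<one>\<^bsub>?R\<^esub>"
    by (intro eqI) (auto simp: mat_alg_simps e_carrier, auto simp: Uinj_eq split: if_splits)
  have inj: "inj_on (end_mat K S) (sp_hom K S U U)"
  proof (rule inj_onI)
    fix f g assume f: "f \<in> sp_hom K S U U" and g: "g \<in> sp_hom K S U U" and eq: "end_mat K S f = end_mat K S g"
    show "f = g"
    proof (rule sp_hom_Usp_eqI[OF poset_space_Usp f g])
      fix A assume A: "A \<in> I"
      have "f (e A) B = g (e A) B" if "B \<in> I" for B using end_mat_apply[OF that A] eq by metis
      then show "f (e A) = g (e A)"
        using sp_homD(4)[OF f e_carrier] sp_homD(4)[OF g e_carrier]
        by (intro PiE_ext[of _ I "\<lambda>_. carrier K"]) (auto simp: Usp_simps)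
    qed
  qed
  have surj: "M \<in> end_mat K S ` sp_hom K S U U" if M: "M \<in> carrier ?R" for M
  proof -
    \<comment> \<open>The columns of \<open>M\<close> serve as the prescribed values on the vectors
      \<open>e A\<close>.\<close>
    let ?v = "\<lambda>A. \<lambda>B\<in>I. M (B, A)"
    have v: "?v A \<in> carrier (meet_space U A)" if "A \<in> I" for A
      using M that by (auto simp: carrier_incidence_inv_Ahat carrier_meet_space_Usp)
    have h: "row_hom U ?v \<in> sp_hom K S U U" "\<And>A. A \<in> I \<Longrightarrow> row_hom U ?v (e A) = ?v A"
      by (rule row_hom[OF poset_space_Usp v], assumption+)+
    have "end_mat K S (row_hom U ?v) = M"
      using M h(2) by (intro eqI) (auto simp: carrier_incidence_inv_Ahat PiE_iff)
    from imageI[OF h(1), of "end_mat K S", unfolded this] show ?thesis .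
  qed
  have "bij_betw (end_mat K S) (carrier (end_alg K S U)) (carrier ?R)"
    using inj R surj by (auto simp: bij_betw_def)
  moreover have "end_mat K S \<in> ring_hom (end_alg K S U) ?R"
    using R mult add one by (auto simp: ring_hom_def simp del: end_alg_simps(2-) incidence_simps)
  ultimately show ?thesis using lin by (simp add: alg_iso_def vs_iso_def)
qed

text \<open>The endomorphism is projection to the summand \<open>A\<close>, then \<open>h\<close>,
  then the injection at \<open>B\<close>. It kills \<open>e A'\<close> for A' different from
  \<open>A\<close>, since \<open>h\<close> sends zero to zero, and takes \<open>e A\<close> to h(1)
  at position \<open>B\<close>.\<close>

lemma end_mat_component:
  assumes A: "A \<in> I" and B: "B \<in> I" and h: "h \<in> sp_hom K S (kA K S A) (kA K S B)"
  shows "end_mat K S (\<lambda>u\<in>carrier (amb U). Uinj K S B (h (dsum_proj A u))) =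
    h \<one>\<^bsub>K\<^esub> \<odot>\<^bsub>mat_alg K (Ahat S)\<^esub> mat_unit K (Ahat S) B A"
proof -
  interpret h: linear_map K "self_space K" "self_space K" h
    using linear_map_sp_hom[OF poset_space_kA[OF A] poset_space_kA[OF B] h] by (simp add: kA_def)
  have h: "h \<zero>\<^bsub>K\<^esub> = \<zero>\<^bsub>K\<^esub>" "h \<one>\<^bsub>K\<^esub> \<in> carrier K"
    using h.T0_is_0 h.T_im[of "\<one>\<^bsub>K\<^esub>"] by (simp_all add: self_space_def)
  show ?thesis
  proof (rule extensionalityI[of _ "I \<times> I"])
    fix p assume "p \<in> I \<times> I"
    then obtain B' A' where p: "p = (B', A')" "B' \<in> I" "A' \<in> I" by auto
    have eA: "e A' A = (if A' = A then \<one>\<^bsub>K\<^esub> else \<zero>\<^bsub>K\<^esub>)" using A by (auto simp: Uinj_eq)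
    show "end_mat K S (\<lambda>u\<in>carrier (amb U). Uinj K S B (h (dsum_proj A u))) p =
        (h \<one>\<^bsub>K\<^esub> \<odot>\<^bsub>mat_alg K (Ahat S)\<^esub> mat_unit K (Ahat S) B A) p"
      using p h B by (simp add: end_mat_apply e_carrier dsum_proj_def eA mat_alg_simps mat_unit_def)
        (simp add: Uinj_eq)
  qed (auto simp: end_mat_def mat_alg_simps)
qed

section \<open>The module of morphisms\<close>

abbreviation "R \<equiv> incidence K (Ahat S)"

text \<open>The transpose of the pattern in \<open>carrier_incidence_inv_Ahat\<close>, as needed for
  \<open>act\<close>.\<close>

lemma carrier_R:
  "carrier R = {M \<in> I \<times> I \<rightarrow>\<^sub>E carrier K. \<forall>A\<in>I. \<forall>B\<in>I. \<not> B \<sqsubseteq>\<^bsub>Ahat S\<^esub> A \<longrightarrow> M (A, B) = \<zero>\<^bsub>K\<^esub>}"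
  by (simp add: carrier_incidence[OF field_K finite_Ahat] mat_alg_simps)

lemma ring_R: "ring R"
  by (rule ring_incidence[OF field_K finite_Ahat Ahat_refl Ahat_trans])

lemma mat_unit_R:
  assumes "B \<sqsubseteq>\<^bsub>Ahat S\<^esub> A"
  shows "mat_unit K (Ahat S) A B \<in> carrier R"
  using assms by (auto simp: carrier_R mat_unit_def split: if_splits)

lemma scalar_R: "c \<in> carrier K \<Longrightarrow> c \<odot>\<^bsub>R\<^esub> \<one>\<^bsub>R\<^esub> \<in> carrier R"
  using Ahat_refl by (auto simp: carrier_R mat_alg_simps split: if_splits)

text \<open>A name for the endomorphism hidden in the scalar multiplication of \<open>HomU\<close>.
  Because of the transposition, row \<open>A\<close> of \<open>x\<close> is the image of
  \<open>e A\<close>.\<close>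

definition act :: "('s set \<times> 's set \<Rightarrow> 'k) \<Rightarrow> ('s set \<Rightarrow> 'k) \<Rightarrow> ('s set \<Rightarrow> 'k)" where
  "act x = inv_into (sp_hom K S U U) (end_mat K S) (mat_transpose (Ahat S) x)"

lemma act:
  assumes x: "x \<in> carrier R"
  shows "act x \<in> sp_hom K S U U"
    and "A \<in> I \<Longrightarrow> B \<in> I \<Longrightarrow> act x (e A) B = x (A, B)"
proof -
  \<comment> \<open>The transposed matrix lies in the range of \<open>end_mat\<close>, so
    \<open>inv_into\<close> returns a genuine preimage.\<close>
  have "mat_transpose (Ahat S) x \<in> carrier (incidence K (inv_gorder (Ahat S)))"
    using x by (auto simp: carrier_R carrier_incidence_inv_Ahat mat_transpose_def)
  then have T: "mat_transpose (Ahat S) x \<in> end_mat K S ` sp_hom K S U U"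
    using alg_iso_end_mat by (simp add: alg_iso_def vs_iso_def bij_betw_def)
  then show "act x \<in> sp_hom K S U U" unfolding act_def by (rule inv_into_into)
  have "end_mat K S (act x) = mat_transpose (Ahat S) x" unfolding act_def using T by (rule f_inv_into_f)
  then show "act x (e A) B = x (A, B)" if "A \<in> I" "B \<in> I"
    using that end_mat_apply[of B A "act x"] by (simp add: mat_transpose_def)
qed

lemma Usp_eqI:
  assumes "u \<in> carrier (amb U)" "w \<in> carrier (amb U)" "\<And>B. B \<in> I \<Longrightarrow> u B = w B"
  shows "u = w"
  using assms by (intro PiE_ext[of u I "\<lambda>_. carrier K" w]) (auto simp: Usp_simps)

text \<open>\<open>act\<close> is defined by a choice of preimage; this characterisation by entries
  makes its sums, products and special values computable.\<close>

lemma act_eqI: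
  assumes x: "x \<in> carrier R" and f: "f \<in> sp_hom K S U U"
    and eq: "\<And>A B. A \<in> I \<Longrightarrow> B \<in> I \<Longrightarrow> f (e A) B = x (A, B)"
  shows "act x = f"
proof (rule sp_hom_Usp_eqI[OF poset_space_Usp act(1)[OF x] f])
  fix A assume A: "A \<in> I"
  show "act x (e A) = f (e A)"
    by (rule Usp_eqI) (simp_all add: sp_homD(4)[OF act(1)[OF x] e_carrier] sp_homD(4)[OF f e_carrier] act(2)[OF x] eq A)
qed

lemma act_add:
  assumes x: "x \<in> carrier R" and y: "y \<in> carrier R"
  shows "act (x \<oplus>\<^bsub>R\<^esub> y) = (\<lambda>u\<in>carrier (amb U). act x u \<oplus>\<^bsub>amb U\<^esub> act y u)"
proof (rule act_eqI)
  interpret R: ring R by (rule ring_R)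
  show "x \<oplus>\<^bsub>R\<^esub> y \<in> carrier R" using x y by (rule R.a_closed)
  interpret H: vectorspace K "hom_space K S U U" by (intro vectorspace_hom_space poset_space_Usp)
  show "(\<lambda>u\<in>carrier (amb U). act x u \<oplus>\<^bsub>amb U\<^esub> act y u) \<in> sp_hom K S U U"
    using H.M.a_closed[of "act x" "act y"] act(1) x y by simp
  show "(\<lambda>u\<in>carrier (amb U). act x u \<oplus>\<^bsub>amb U\<^esub> act y u) (e A) B = (x \<oplus>\<^bsub>R\<^esub> y) (A, B)"
    if "A \<in> I" "B \<in> I" for A B
    using that act(2)[OF x that] act(2)[OF y that] e_carrier[of A]
    by (simp add: mat_alg_simps) (simp add: amb_Usp dsum_space_def self_space_def)
qed

text \<open>Row \<open>A\<close> of the product is the combination of the rows of \<open>y\<close>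
  with coefficients from row \<open>A\<close> of \<open>x\<close>, that is, \<open>act y\<close>
  applied to \<open>act x (e A)\<close>. The reversal of factors is what makes precomposition a left
  action; commutativity of the field reorders the scalars.\<close>

lemma act_mult:
  assumes x: "x \<in> carrier R" and y: "y \<in> carrier R"
  shows "act (x \<otimes>\<^bsub>R\<^esub> y) = compose (carrier (amb U)) (act y) (act x)"
proof (rule act_eqI)
  interpret R: ring R by (rule ring_R)
  show "x \<otimes>\<^bsub>R\<^esub> y \<in> carrier R" using x y by (rule R.m_closed)
  show "compose (carrier (amb U)) (act y) (act x) \<in> sp_hom K S U U"
    by (intro compose_sp_hom[where V = U] poset_space_Usp act x y)
  fix A B assume A: "A \<in> I" and B: "B \<in> I"
  have K: "x (C, D) \<in> carrier K" "y (C, D) \<in> carrier K" if "C \<in> I" "D \<in> I" for C D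
    using x y that by (auto simp: carrier_R)
  have "compose (carrier (amb U)) (act y) (act x) (e A) B = act y (act x (e A)) B"
    by (simp add: compose_def e_carrier)
  also have "\<dots> = (\<Oplus>\<^bsub>K\<^esub>C\<in>I. act y (e C) B \<otimes>\<^bsub>K\<^esub> act x (e A) C)"
    by (intro endomorphism_Usp_apply act y B sp_homD(4)[OF act(1)[OF x]] e_carrier)
  also have "\<dots> = (\<Oplus>\<^bsub>K\<^esub>C\<in>I. x (A, C) \<otimes>\<^bsub>K\<^esub> y (C, B))"
    using A B by (intro K.finsum_cong') (auto simp: act(2) x y K intro!: K.m_comm)
  finally show "compose (carrier (amb U)) (act y) (act x) (e A) B = (x \<otimes>\<^bsub>R\<^esub> y) (A, B)"
    using A B by (simp add: mat_alg_simps)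
qed

text \<open>Scalar matrices act as homotheties. Hence the scalar multiplication that
  \<open>Phi\<close> reads off through multiples of the identity of \<open>R\<close> is the
  pointwise one.\<close>

lemma act_scalar:
  assumes c: "c \<in> carrier K"
  shows "act (c \<odot>\<^bsub>R\<^esub> \<one>\<^bsub>R\<^esub>) = (\<lambda>u\<in>carrier (amb U). c \<odot>\<^bsub>amb U\<^esub> u)"
proof (rule act_eqI[OF scalar_R[OF c]])
  interpret H: vectorspace K "hom_space K S U U" by (intro vectorspace_hom_space poset_space_Usp)
  show "(\<lambda>u\<in>carrier (amb U). c \<odot>\<^bsub>amb U\<^esub> u) \<in> sp_hom K S U U"
    using H.smult_closed[OF c, of "\<lambda>u\<in>carrier (amb U). u"] id_sp_hom[OF poset_space_Usp]
    by (simp cong: restrict_cong)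
  show "(\<lambda>u\<in>carrier (amb U). c \<odot>\<^bsub>amb U\<^esub> u) (e A) B = (c \<odot>\<^bsub>R\<^esub> \<one>\<^bsub>R\<^esub>) (A, B)"
    if "A \<in> I" "B \<in> I" for A B
    using that e_carrier[of A] c
    by (cases "A = B") (simp_all add: mat_alg_simps, simp_all add: amb_Usp dsum_space_def self_space_def Uinj_eq)
qed

lemma act_one: "act \<one>\<^bsub>R\<^esub> = (\<lambda>u\<in>carrier (amb U). u)"
proof (rule act_eqI)
  show "\<one>\<^bsub>R\<^esub> \<in> carrier R" using ring_R by (rule ring.ring_simprules)
  show "(\<lambda>u\<in>carrier (amb U). u) \<in> sp_hom K S U U" by (rule id_sp_hom[OF poset_space_Usp])
  show "(\<lambda>u\<in>carrier (amb U). u) (e A) B = \<one>\<^bsub>R\<^esub> (A, B)" if "A \<in> I" "B \<in> I" for A B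
    using that e_carrier[of A] by (cases "A = B") (simp_all add: mat_alg_simps, simp_all add: Uinj_eq)
qed

lemma act_mat_unit:
  assumes A: "A \<in> I" and B: "B \<in> I" and le: "B \<sqsubseteq>\<^bsub>Ahat S\<^esub> A" and C: "C \<in> I"
  shows "act (mat_unit K (Ahat S) A B) (e C) = (if C = A then e B else \<zero>\<^bsub>amb U\<^esub>)"
proof (rule Usp_eqI)
  show "act (mat_unit K (Ahat S) A B) (e C) \<in> carrier (amb U)"
    by (intro sp_homD(4)[OF act(1)] e_carrier mat_unit_R le)
  show "(if C = A then e B else \<zero>\<^bsub>amb U\<^esub>) \<in> carrier (amb U)"
    using e_carrier by (auto simp: amb_Usp dsum_space_def self_space_def)
  show "act (mat_unit K (Ahat S) A B) (e C) D = (if C = A then e B else \<zero>\<^bsub>amb U\<^esub>) D" if "D \<in> I" for D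
    unfolding act(2)[OF mat_unit_R[OF le] C that] using that A B C
    by (simp add: mat_unit_def Uinj_eq) (simp add: amb_Usp dsum_space_def self_space_def)
qed

lemma HomU_simps [simp]:
  "carrier (HomU K S V) = sp_hom K S U V"
  "\<zero>\<^bsub>HomU K S V\<^esub> = (\<lambda>u\<in>carrier (amb U). \<zero>\<^bsub>amb V\<^esub>)"
  "f \<oplus>\<^bsub>HomU K S V\<^esub> g = (\<lambda>u\<in>carrier (amb U). f u \<oplus>\<^bsub>amb V\<^esub> g u)"
  "x \<odot>\<^bsub>HomU K S V\<^esub> f = compose (carrier (amb U)) f (act x)"
  by (simp_all add: HomU_def Let_def act_def)

text \<open>The additive group is that of \<open>hom_space\<close>. Since \<open>x\<close> acts by
  composing f with \<open>act x\<close>, additivity in \<open>x\<close> is linearity of f,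
  additivity in f is pointwise, and associativity is the reversal in
  \<open>act_mult\<close>.\<close>

lemma left_module_HomU:
  assumes V: "poset_space K S V"
  shows "left_module R (HomU K S V)"
proof -
  interpret V: vectorspace K "amb V" by (rule poset_spaceD) fact
  interpret H: vectorspace K "hom_space K S U V" by (intro vectorspace_hom_space poset_space_Usp V)
  have "\<exists>g\<in>sp_hom K S U V. (\<lambda>u\<in>carrier (amb U). g u \<oplus>\<^bsub>amb V\<^esub> f u) = (\<lambda>u\<in>carrier (amb U). \<zero>\<^bsub>amb V\<^esub>)"
    if "f \<in> sp_hom K S U V" for f
    using H.M.l_neg[of f] H.M.a_inv_closed[of f] that by auto
  then have "abelian_group (HomU K S V)"
    using H.M.a_closed H.M.zero_closed H.M.a_assoc H.M.a_comm H.M.l_zero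
    by (intro abelian_groupI) simp_all
  moreover have "left_module_axioms R (HomU K S V)"
  proof
    fix x f assume x: "x \<in> carrier R" and f: "f \<in> carrier (HomU K S V)"
    then show "x \<odot>\<^bsub>HomU K S V\<^esub> f \<in> carrier (HomU K S V)"
      by (auto intro!: compose_sp_hom[where V = U] poset_space_Usp V act)
  next
    fix x y f assume x: "x \<in> carrier R" and y: "y \<in> carrier R" and f: "f \<in> carrier (HomU K S V)"
    then have f: "f \<in> sp_hom K S U V" by simp
    have c: "act x u \<in> carrier (amb U)" "act y u \<in> carrier (amb U)" if "u \<in> carrier (amb U)" for u
      using sp_homD(4)[OF act(1)[OF x] that] sp_homD(4)[OF act(1)[OF y] that] by auto
    show "(x \<oplus>\<^bsub>R\<^esub> y) \<odot>\<^bsub>HomU K S V\<^esub> f = x \<odot>\<^bsub>HomU K S V\<^esub> f \<oplus>\<^bsub>HomU K S V\<^esub> y \<odot>\<^bsub>HomU K S V\<^esub> f"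
      unfolding HomU_simps act_add[OF x y] compose_def
      by (rule restrict_ext) (simp add: module_hom_add[OF sp_homD(1)[OF f]] c)
    show "(x \<otimes>\<^bsub>R\<^esub> y) \<odot>\<^bsub>HomU K S V\<^esub> f = x \<odot>\<^bsub>HomU K S V\<^esub> (y \<odot>\<^bsub>HomU K S V\<^esub> f)"
      unfolding HomU_simps act_mult[OF x y] compose_def
      by (rule restrict_ext) (simp add: c)
  next
    fix x f g assume x: "x \<in> carrier R" and f: "f \<in> carrier (HomU K S V)" and g: "g \<in> carrier (HomU K S V)"
    have c: "act x u \<in> carrier (amb U)" if "u \<in> carrier (amb U)" for u
      by (rule sp_homD(4)[OF act(1)[OF x] that])
    show "x \<odot>\<^bsub>HomU K S V\<^esub> (f \<oplus>\<^bsub>HomU K S V\<^esub> g) = x \<odot>\<^bsub>HomU K S V\<^esub> f \<oplus>\<^bsub>HomU K S V\<^esub> x \<odot>\<^bsub>HomU K S V\<^esub> g"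
      unfolding HomU_simps compose_def by (rule restrict_ext) (simp add: c)
  next
    fix f assume "f \<in> carrier (HomU K S V)"
    then have f: "f \<in> extensional (carrier (amb U))" by (simp add: sp_homD(2))
    show "\<one>\<^bsub>R\<^esub> \<odot>\<^bsub>HomU K S V\<^esub> f = f"
      unfolding HomU_simps act_one compose_def
      by (rule extensionalityI[OF _ f]) simp_all
  qed
  ultimately show ?thesis by (intro left_module.intro ring_R)
qed

lemma HomU_scalar:
  assumes c: "c \<in> carrier K" and f: "f \<in> sp_hom K S U V"
  shows "(c \<odot>\<^bsub>R\<^esub> \<one>\<^bsub>R\<^esub>) \<odot>\<^bsub>HomU K S V\<^esub> f = c \<odot>\<^bsub>hom_space K S U V\<^esub> f"
  unfolding HomU_simps hom_space_simps act_scalar[OF c] compose_def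
  by (rule restrict_ext) (simp add: module_hom_smult[OF sp_homD(1)[OF f]] c)

lemma HomU_mat_unit_e:
  assumes V: "poset_space K S V" and f: "f \<in> sp_hom K S U V"
    and "A \<in> I" "B \<in> I" "B \<sqsubseteq>\<^bsub>Ahat S\<^esub> A" "C \<in> I"
  shows "(mat_unit K (Ahat S) A B \<odot>\<^bsub>HomU K S V\<^esub> f) (e C) = (if C = A then f (e B) else \<zero>\<^bsub>amb V\<^esub>)"
proof -
  interpret f: linear_map K "amb U" "amb V" f by (intro linear_map_sp_hom[where P = S] poset_space_Usp V f)
  show ?thesis using e_carrier by (simp add: compose_def act_mat_unit[OF assms(3-6)])
qed

text \<open>The space of morphisms is finite-dimensional over \<open>K\<close>, and scalars act
  through \<open>R\<close>, so a finite generating set over \<open>K\<close> also generates over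
  \<open>R\<close>.\<close>

lemma fin_gen_HomU:
  assumes V: "poset_space K S V"
  shows "fin_gen R (HomU K S V)"
proof -
  interpret H: vectorspace K "hom_space K S U V" by (intro vectorspace_hom_space poset_space_Usp V)
  have "vectorspace.fin_dim K (dsum_space I (meet_space V))"
    using Ahat_subset by (intro fin_dim_dsum_space finite_Ahat field_K meet_space V) auto
  \<comment> \<open>Finite dimension is pulled back along \<open>rowvec\<close> from the finite
    direct sum of the subspaces V(C).\<close>
  then have "H.fin_dim" by (rule fin_dim_vs_iso[OF vs_iso_inv[OF vs_iso_rowvec[OF V]]])
  then obtain G where G: "finite G" "G \<subseteq> sp_hom K S U V" "H.span G = sp_hom K S U V"
    by (auto simp: H.fin_dim_def)
  have "\<exists>c\<in>G \<rightarrow> carrier R. f = (\<Oplus>\<^bsub>HomU K S V\<^esub>g\<in>G. c g \<odot>\<^bsub>HomU K S V\<^esub> g)"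
    if f: "f \<in> sp_hom K S U V" for f
  proof -
    obtain a where a: "a \<in> G \<rightarrow> carrier K" "H.lincomb a G = f"
      using H.finite_in_span[OF G(1), of f] G f by auto
    let ?c = "\<lambda>g. a g \<odot>\<^bsub>R\<^esub> \<one>\<^bsub>R\<^esub>"
    have "f = (\<Oplus>\<^bsub>hom_space K S U V\<^esub>g\<in>G. a g \<odot>\<^bsub>hom_space K S U V\<^esub> g)"
      using a(2) by (simp add: H.lincomb_def)
    also have "\<dots> = (\<Oplus>\<^bsub>hom_space K S U V\<^esub>g\<in>G. ?c g \<odot>\<^bsub>HomU K S V\<^esub> g)"
    proof (rule H.M.finsum_cong'[symmetric])
      show "(\<lambda>g. a g \<odot>\<^bsub>hom_space K S U V\<^esub> g) \<in> G \<rightarrow> carrier (hom_space K S U V)"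
        using a(1) G(2) by (intro Pi_I H.smult_closed) auto
      show "?c g \<odot>\<^bsub>HomU K S V\<^esub> g = a g \<odot>\<^bsub>hom_space K S U V\<^esub> g" if "g \<in> G" for g
        using a(1) G(2) that by (intro HomU_scalar) auto
    qed simp
    \<comment> \<open>Both records have the same additive structure, so finite sums in them
      coincide.\<close>
    also have "\<dots> = (\<Oplus>\<^bsub>HomU K S V\<^esub>g\<in>G. ?c g \<odot>\<^bsub>HomU K S V\<^esub> g)"
      by (simp add: finsum_def finprod_def HomU_def Let_def)
    finally show ?thesis using a(1) scalar_R by (intro bexI[of _ ?c]) auto
  qed
  then show ?thesis using G by (auto simp: fin_gen_def simp del: HomU_simps(2-))
qed

section \<open>Functoriality of morphisms out of \<open>U\<close>\<close>

lemma HomU_map_mem: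
  assumes V: "poset_space K S V" and W: "poset_space K S W" and g: "g \<in> sp_hom K S V W"
  shows "HomU_map K S V W g \<in> lin_maps R (HomU K S V) (HomU K S W)"
proof -
  interpret g: linear_map K "amb V" "amb W" g by (rule linear_map_sp_hom) fact+
  have comp: "compose (carrier (amb U)) g f \<in> sp_hom K S U W" if "f \<in> sp_hom K S U V" for f
    by (intro compose_sp_hom[where V = V] poset_space_Usp V W g that)
  interpret M: left_module R "HomU K S V" by (rule left_module_HomU) fact
  have "compose (carrier (amb U)) g (f \<oplus>\<^bsub>HomU K S V\<^esub> h) =
      compose (carrier (amb U)) g f \<oplus>\<^bsub>HomU K S W\<^esub> compose (carrier (amb U)) g h"
    if f: "f \<in> sp_hom K S U V" and h: "h \<in> sp_hom K S U V" for f h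
    unfolding HomU_simps compose_def
    by (rule restrict_ext) (simp add: sp_homD(4)[OF f] sp_homD(4)[OF h])
  \<comment> \<open>Postcomposition with \<open>g\<close> commutes with precomposition by
    \<open>act x\<close>; this is the linearity over \<open>R\<close>.\<close>
  moreover have "compose (carrier (amb U)) g (x \<odot>\<^bsub>HomU K S V\<^esub> f) =
      x \<odot>\<^bsub>HomU K S W\<^esub> compose (carrier (amb U)) g f"
    if x: "x \<in> carrier R" and f: "f \<in> sp_hom K S U V" for x f
    unfolding HomU_simps compose_def
    by (rule restrict_ext) (simp add: sp_homD(4)[OF act(1)[OF x]])
  ultimately show ?thesis
    using comp M.a_closed M.lsmult_closed
    by (auto simp: lin_maps_def module_hom_def HomU_map_def simp del: HomU_simps(2-))
qed

lemma HomU_map_id: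
  "HomU_map K S V V (\<lambda>x\<in>carrier (amb V). x) = (\<lambda>f\<in>sp_hom K S U V. f)"
  unfolding HomU_map_def
proof (rule restrict_ext)
  fix f assume f: "f \<in> sp_hom K S U V"
  show "compose (carrier (amb U)) (\<lambda>x\<in>carrier (amb V). x) f = f"
    using sp_homD(2,4)[OF f] by (intro extensionalityI[of _ "carrier (amb U)"]) (auto simp: compose_def)
qed

lemma HomU_map_compose:
  assumes V: "poset_space K S V" and W: "poset_space K S W" and f: "f \<in> sp_hom K S V W"
  shows "HomU_map K S V X (compose (carrier (amb V)) g f) =
    compose (sp_hom K S U V) (HomU_map K S W X g) (HomU_map K S V W f)"
proof -
  have "compose (carrier (amb U)) f h \<in> sp_hom K S U W" if "h \<in> sp_hom K S U V" for h
    by (intro compose_sp_hom[where V = V] poset_space_Usp V W f that)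
  then show ?thesis
    unfolding HomU_map_def compose_def[of "sp_hom K S U V"]
    by (intro restrict_ext) (simp add: compose_def sp_homD(4) cong: restrict_cong)
qed

lemma is_functor_HomU:
  "is_functor (sp_cat K S :: (('k, 'v, 's) sspace, 'v) ccat) (fgmod_cat R) (HomU K S) (HomU_map K S)"
  unfolding is_functor_def
proof (intro conjI ballI)
  fix X :: "('k, 'v, 's) sspace" assume X: "X \<in> objs (sp_cat K S)"
  then have X: "poset_space K S X" by (simp add: sp_cat_def)
  show "HomU K S X \<in> objs (fgmod_cat R)"
    by (simp add: fgmod_cat_def left_module_HomU[OF X] fin_gen_HomU[OF X])
  show "HomU_map K S X X (\<lambda>x\<in>und (sp_cat K S) X. x) = (\<lambda>x\<in>und (fgmod_cat R) (HomU K S X). x)"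
    by (simp add: sp_cat_def fgmod_cat_def HomU_map_id)
  fix Y :: "('k, 'v, 's) sspace" and f
  assume Y: "Y \<in> objs (sp_cat K S)" and f: "f \<in> homs (sp_cat K S) X Y"
  have Y: "poset_space K S Y" and f: "f \<in> sp_hom K S X Y" using Y f by (simp_all add: sp_cat_def)
  show "HomU_map K S X Y f \<in> homs (fgmod_cat R) (HomU K S X) (HomU K S Y)"
    using HomU_map_mem[OF X Y f] by (simp add: fgmod_cat_def)
  fix Z :: "('k, 'v, 's) sspace" and g
  show "HomU_map K S X Z (compose (und (sp_cat K S) X) g f) =
      compose (und (fgmod_cat R) (HomU K S X)) (HomU_map K S Y Z g) (HomU_map K S X Y f)"
    using HomU_map_compose[OF X Y f] by (simp add: fgmod_cat_def sp_cat_def)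
qed

section \<open>Morphisms supported on one summand\<close>

definition single_hom :: "('k, 'v, 's) sspace \<Rightarrow> 's set \<Rightarrow> 'v \<Rightarrow> ('s set \<Rightarrow> 'k) \<Rightarrow> 'v" where
  "single_hom V A v = row_hom V (\<lambda>C. if C = A then v else \<zero>\<^bsub>amb V\<^esub>)"

text \<open>Zero is admissible at every \<open>C\<close>, so a single entry v at \<open>A\<close>
  extends to an admissible row vector. For \<open>A\<close> equal to \<open>{}\<close> every v in V
  is allowed, and the construction inverts evaluation at \<open>e {}\<close>.\<close>

lemma single_hom:
  assumes V: "poset_space K S V" and v: "v \<in> carrier (meet_space V A)"
  shows "single_hom V A v \<in> sp_hom K S U V"
    and "C \<in> I \<Longrightarrow> single_hom V A v (e C) = (if C = A then v else \<zero>\<^bsub>amb V\<^esub>)"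
proof -
  have "(if C = A then v else \<zero>\<^bsub>amb V\<^esub>) \<in> carrier (meet_space V C)" if C: "C \<in> I" for C
    using v submodule.zero_closed[OF submodule_meet[OF V, of C]] Ahat_subset[OF C] by auto
  note h = row_hom[OF V, of "\<lambda>C. if C = A then v else \<zero>\<^bsub>amb V\<^esub>", OF this]
  show "single_hom V A v \<in> sp_hom K S U V"
    unfolding single_hom_def by (rule h(1))
  show "single_hom V A v (e C) = (if C = A then v else \<zero>\<^bsub>amb V\<^esub>)" if "C \<in> I"
    unfolding single_hom_def by (rule h(2)) (simp_all add: that)
qed

lemma meet_space_empty: "carrier (meet_space V {}) = carrier (amb V)"
  by (simp add: carrier_meet_space)

lemma HomU_mat_unit:
  assumes V: "poset_space K S V" and f: "f \<in> sp_hom K S U V" and A: "A \<in> I"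
  shows "mat_unit K (Ahat S) {} A \<odot>\<^bsub>HomU K S V\<^esub> f = single_hom V {} (f (e A))"
proof (rule sp_hom_Usp_eqI[OF V])
  interpret M: left_module R "HomU K S V" by (rule left_module_HomU) fact
  \<comment> \<open>The empty antichain is the maximum, so the matrix unit in row \<open>{}\<close>
    and column \<open>A\<close> belongs to \<open>R\<close> for every \<open>A\<close>.\<close>
  have le: "A \<sqsubseteq>\<^bsub>Ahat S\<^esub> {}" by (simp add: Ahat_le)
  show "mat_unit K (Ahat S) {} A \<odot>\<^bsub>HomU K S V\<^esub> f \<in> sp_hom K S U V"
    using M.lsmult_closed[OF mat_unit_R[OF le], of f] f by (simp del: HomU_simps(2-))
  have "f (e A) \<in> carrier (meet_space V {})"
    unfolding meet_space_empty by (rule sp_homD(4)[OF f e_carrier])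
  note s = single_hom[OF V this]
  show "single_hom V {} (f (e A)) \<in> sp_hom K S U V" by (rule s)
  show "(mat_unit K (Ahat S) {} A \<odot>\<^bsub>HomU K S V\<^esub> f) (e C) = single_hom V {} (f (e A)) (e C)" if "C \<in> I" for C
    unfolding s(2)[OF that] by (rule HomU_mat_unit_e[OF V f empty_Ahat A le that])
qed

lemma HomU_mat_unit_image:
  assumes V: "poset_space K S V" and A: "A \<in> I"
  shows "(\<lambda>f. mat_unit K (Ahat S) {} A \<odot>\<^bsub>HomU K S V\<^esub> f) ` sp_hom K S U V =
    single_hom V {} ` carrier (meet_space V A)"
proof -
  have "(\<lambda>f. f (e A)) ` sp_hom K S U V = carrier (meet_space V A)"
  proof (intro equalityI subsetI)
    fix v assume v: "v \<in> carrier (meet_space V A)"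
    \<comment> \<open>Every v in V(A) occurs as a value at \<open>e A\<close>: the morphism
      supported on the summand \<open>A\<close> takes it.\<close>
    show "v \<in> (\<lambda>f. f (e A)) ` sp_hom K S U V"
      using single_hom[OF V v] A by (intro image_eqI[of _ _ "single_hom V A v"]) auto
  qed (use sp_hom_e_mem A in auto)
  moreover have "(\<lambda>f. mat_unit K (Ahat S) {} A \<odot>\<^bsub>HomU K S V\<^esub> f) ` sp_hom K S U V =
      (\<lambda>f. single_hom V {} (f (e A))) ` sp_hom K S U V"
    by (intro image_cong refl HomU_mat_unit V A)
  ultimately show ?thesis by (metis image_image)
qed

section \<open>Evaluation at the unit vector of the maximal summand\<close>

abbreviation "\<Phi> V \<equiv> Phi K (ahat S) {} (HomU K S V)"

text \<open>The ambient space is the case \<open>A\<close> = \<open>{}\<close> of the image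
  computation, since V at the empty antichain is all of V. The incidence algebra in
  \<open>Phi\<close> is \<open>R\<close> because adjoining \<open>{}\<close> to
  \<open>ahat S\<close> gives \<open>Ahat S\<close>.\<close>

lemma Phi_HomU:
  assumes V: "poset_space K S V"
  shows "carrier (amb (\<Phi> V)) = single_hom V {} ` carrier (amb V)"
    and "\<zero>\<^bsub>amb (\<Phi> V)\<^esub> = \<zero>\<^bsub>HomU K S V\<^esub>"
    and "add (amb (\<Phi> V)) = add (HomU K S V)"
    and "c \<odot>\<^bsub>amb (\<Phi> V)\<^esub> f = (c \<odot>\<^bsub>R\<^esub> \<one>\<^bsub>R\<^esub>) \<odot>\<^bsub>HomU K S V\<^esub> f"
    and "A \<in> I \<Longrightarrow> sub (\<Phi> V) A = single_hom V {} ` carrier (meet_space V A)"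
  using HomU_mat_unit_image[OF V empty_Ahat] HomU_mat_unit_image[OF V, of A]
  by (simp_all add: Phi_def Let_def omega_ext_ahat meet_space_empty del: HomU_simps(2-))

lemma Phi_carrier_e:
  assumes V: "poset_space K S V" and f: "f \<in> carrier (amb (\<Phi> V))"
  shows "f \<in> sp_hom K S U V" "f (e {}) \<in> carrier (amb V)" "single_hom V {} (f (e {})) = f"
  using f single_hom[OF V, of _ "{}"] empty_Ahat by (auto simp: Phi_HomU[OF V] meet_space_empty)

lemma single_hom_e:
  assumes "poset_space K S V" "v \<in> carrier (amb V)"
  shows "single_hom V {} v (e {}) = v"
  using single_hom(2)[OF assms(1), of v "{}" "{}"] assms(2) empty_Ahat by (simp add: meet_space_empty)

text \<open>The carrier is only known as an image under a matrix unit. As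
  \<open>single_hom V {}\<close> is linear and inverse to evaluation, the vector space axioms can be
  carried back from \<open>amb V\<close>.\<close>

lemma Phi_vs_iso:
  assumes V: "poset_space K S V"
  shows "vs_iso K (amb (\<Phi> V)) (amb V) (\<lambda>f. f (e {}))"
proof -
  interpret V: vectorspace K "amb V" by (rule poset_spaceD) fact
  let ?s = "single_hom V {}" and ?C = "carrier (amb (\<Phi> V))"
  interpret H: vectorspace K "hom_space K S U V" by (intro vectorspace_hom_space poset_space_Usp V)
  note s = single_hom[OF V, of _ "{}", unfolded meet_space_empty]
  have zero: "?s \<zero>\<^bsub>amb V\<^esub> = \<zero>\<^bsub>hom_space K S U V\<^esub>"
    using H.M.zero_closed e_carrier
    by (intro sp_hom_Usp_eqI[OF V] s) (simp_all add: s)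
  have add: "?s (v \<oplus>\<^bsub>amb V\<^esub> w) = ?s v \<oplus>\<^bsub>hom_space K S U V\<^esub> ?s w"
    if "v \<in> carrier (amb V)" "w \<in> carrier (amb V)" for v w
    using H.M.a_closed[of "?s v" "?s w"] e_carrier that
    by (intro sp_hom_Usp_eqI[OF V] s) (simp_all add: s)
  have smult: "?s (c \<odot>\<^bsub>amb V\<^esub> v) = c \<odot>\<^bsub>hom_space K S U V\<^esub> ?s v"
    if "c \<in> carrier K" "v \<in> carrier (amb V)" for c v
    using H.smult_closed[of c "?s v"] e_carrier that
    by (intro sp_hom_Usp_eqI[OF V] s) (simp_all add: s)
  have C: "?s v \<in> ?C" if "v \<in> carrier (amb V)" for v using that by (simp add: Phi_HomU[OF V])
  \<comment> \<open>Writing each operation as a value of \<open>?s\<close> gives closure of the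
    carrier and compatibility with evaluation at once.\<close>
  have zeroC: "\<zero>\<^bsub>amb (\<Phi> V)\<^esub> = ?s \<zero>\<^bsub>amb V\<^esub>" by (simp add: Phi_HomU[OF V] zero)
  have addC: "f \<oplus>\<^bsub>amb (\<Phi> V)\<^esub> g = ?s (f (e {}) \<oplus>\<^bsub>amb V\<^esub> g (e {}))" if "f \<in> ?C" "g \<in> ?C" for f g
    using that Phi_carrier_e[OF V that(1)] Phi_carrier_e[OF V that(2)]
    by (simp add: add Phi_HomU(3)[OF V])
  have smultC: "c \<odot>\<^bsub>amb (\<Phi> V)\<^esub> f = ?s (c \<odot>\<^bsub>amb V\<^esub> f (e {}))" if "c \<in> carrier K" "f \<in> ?C" for c f
    unfolding Phi_HomU(4)[OF V] HomU_scalar[OF that(1) Phi_carrier_e(1)[OF V that(2)]]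
    using that Phi_carrier_e[OF V that(2)] by (simp add: smult del: hom_space_simps)
  note e = Phi_carrier_e(2)[OF V] single_hom_e[OF V]
  have bij: "bij_betw (\<lambda>f. f (e {})) ?C (carrier (amb V))"
    by (rule bij_betwI[where g = ?s]) (auto simp: e C Phi_carrier_e(3)[OF V])
  have "vectorspace K (amb (\<Phi> V))"
    by (rule vectorspace_transfer[OF V.vectorspace_axioms, where T = "\<lambda>f. f (e {})"])
      (use bij in \<open>auto simp: bij_betw_def zeroC addC smultC e C\<close>)
  moreover have "(\<lambda>f. f (e {})) \<in> module_hom K (amb (\<Phi> V)) (amb V)"
    by (auto simp: module_hom_def addC smultC e)
  ultimately show ?thesis using bij by (simp add: vs_iso_def linear_mapI V.vectorspace_axioms)
qed

lemma carrier_ahat: "A \<in> carrier (ahat S) \<Longrightarrow> A \<in> I"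
  by (simp add: ahat_def)

lemma ahat_le: "A \<sqsubseteq>\<^bsub>ahat S\<^esub> B \<longleftrightarrow> A \<sqsubseteq>\<^bsub>Ahat S\<^esub> B"
  by (simp add: ahat_def)

lemma meet_space_mono:
  assumes V: "poset_space K S V" and A: "A \<in> I" and B: "B \<in> I" and le: "A \<sqsubseteq>\<^bsub>Ahat S\<^esub> B"
  shows "carrier (meet_space V A) \<subseteq> carrier (meet_space V B)"
proof
  fix v assume v: "v \<in> carrier (meet_space V A)"
  have "v \<in> sub V b" if b: "b \<in> B" for b
  proof -
    obtain a where a: "a \<in> A" "a \<sqsubseteq>\<^bsub>S\<^esub> b" using le b by (auto simp: Ahat_le)
    then show ?thesis
      using v poset_spaceD(6)[OF V Ahat_subset[OF A a(1)] Ahat_subset[OF B b]]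
      by (auto simp: carrier_meet_space)
  qed
  then show "v \<in> carrier (meet_space V B)" using v by (simp add: carrier_meet_space)
qed

text \<open>In this form the subspaces are preimages of V(A) under a linear map, so that
  \<open>submodule_preimage\<close> and monotonicity of V(A) in \<open>A\<close> apply.\<close>

lemma sub_Phi:
  assumes V: "poset_space K S V" and A: "A \<in> I"
  shows "sub (\<Phi> V) A = {f \<in> carrier (amb (\<Phi> V)). f (e {}) \<in> carrier (meet_space V A)}"
  using single_hom_e[OF V]
  by (auto simp: Phi_HomU(1)[OF V] Phi_HomU(5)[OF V A] carrier_meet_space)

lemma poset_space_Phi:
  assumes V: "poset_space K S V"
  shows "poset_space K (ahat S) (\<Phi> V)"
proof -
  interpret T: linear_map K "amb (\<Phi> V)" "amb V" "\<lambda>f. f (e {})"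
    using Phi_vs_iso[OF V] by (simp add: vs_iso_def)
  have "subspace K (sub (\<Phi> V) A) (amb (\<Phi> V))" if "A \<in> I" for A
    using submodule_preimage[OF T.linear_map_axioms submodule_meet[OF V, of A]] Ahat_subset[OF that]
      T.V.vectorspace_axioms sub_Phi[OF V that]
    by (auto simp: subspace_def)
  moreover have "sub (\<Phi> V) A \<subseteq> sub (\<Phi> V) B" if "A \<in> I" "B \<in> I" "A \<sqsubseteq>\<^bsub>Ahat S\<^esub> B" for A B
    using meet_space_mono[OF V that] by (auto simp: sub_Phi[OF V] that)
  ultimately show ?thesis
    using fin_dim_vs_iso[OF vs_iso_inv[OF Phi_vs_iso[OF V]] poset_spaceD(2)[OF V]] T.V.vectorspace_axioms
    by (auto simp: poset_space_def ahat_le dest: carrier_ahat)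
qed

section \<open>Coinduction from \<open>S\<close> to \<open>ahat S\<close>\<close>

abbreviation "co \<equiv> coind (ahat S) S (\<lambda>s. {s})"

text \<open>Coinduction intersects V(r) over the whole up-set of \<open>A\<close>. Each a in
  \<open>A\<close> belongs to that up-set, and every other V(r) contains some V(a), so intersecting
  over \<open>A\<close> gives the same subspace.\<close>

lemma coind_simps:
  assumes V: "poset_space K S V"
  shows "amb (co V) = amb V"
    and "A \<in> carrier (ahat S) \<Longrightarrow> sub (co V) A = carrier (meet_space V A)"
proof -
  show "amb (co V) = amb V" by (simp add: coind_def)
  assume "A \<in> carrier (ahat S)"
  then have A: "A \<in> I" by (rule carrier_ahat)
  have le: "A \<sqsubseteq>\<^bsub>ahat S\<^esub> {r} \<longleftrightarrow> (\<exists>a\<in>A. a \<sqsubseteq>\<^bsub>S\<^esub> r)" for r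
    by (simp add: ahat_le Ahat_le)
  have "(\<forall>r\<in>carrier S. (\<exists>a\<in>A. a \<sqsubseteq>\<^bsub>S\<^esub> r) \<longrightarrow> v \<in> sub V r) \<longleftrightarrow> (\<forall>a\<in>A. v \<in> sub V a)" for v
    using Ahat_subset[OF A] S.le_refl poset_spaceD(6)[OF V] by (meson subsetD)
  then show "sub (co V) A = carrier (meet_space V A)"
    by (simp add: coind_def le carrier_meet_space)
qed

lemma poset_space_coind:
  assumes V: "poset_space K S V"
  shows "poset_space K (ahat S) (co V)"
proof -
  have "subspace K (carrier (meet_space V A)) (amb V)" if "A \<in> I" for A
    using submodule_meet[OF V, of A] Ahat_subset[OF that] poset_spaceD(1)[OF V]
    by (auto simp: subspace_def)
  then show ?thesis
    using poset_spaceD(1,2)[OF V] meet_space_mono[OF V]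
    by (simp add: poset_space_def coind_simps[OF V] carrier_ahat ahat_le)
qed

lemma is_functor_coind:
  "is_functor (sp_cat K S :: (('k, 'v, 's) sspace, 'v) ccat) (sp_cat K (ahat S)) co coind_map"
proof -
  have "f \<in> sp_hom K (ahat S) (co X) (co Y)"
    if X: "poset_space K S X" and Y: "poset_space K S Y" and f: "f \<in> sp_hom K S X Y"
    for X Y :: "('k, 'v, 's) sspace" and f
    using sp_homD[OF f] Ahat_subset[OF carrier_ahat]
    by (intro sp_homI) (auto simp: coind_simps[OF X] coind_simps[OF Y] carrier_meet_space)
  then show ?thesis
    by (simp add: is_functor_def sp_cat_def coind_map_def coind_simps poset_space_coind)
qed

section \<open>Naturality of evaluation\<close>

lemma HomU_map_Phi:
  assumes X: "poset_space K S X" and Y: "poset_space K S Y" and g: "g \<in> sp_hom K S X Y"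
    and f: "f \<in> carrier (amb (\<Phi> X))"
  shows "HomU_map K S X Y g f (e {}) = g (f (e {}))"
    and "HomU_map K S X Y g f = single_hom Y {} (g (f (e {})))"
proof -
  interpret g: linear_map K "amb X" "amb Y" g by (rule linear_map_sp_hom) fact+
  note f = Phi_carrier_e[OF X f]
  have v: "g (f (e {})) \<in> carrier (meet_space Y {})" using f by (simp add: meet_space_empty)
  have map: "HomU_map K S X Y g f = compose (carrier (amb U)) g f" using f by (simp add: HomU_map_def)
  then show "HomU_map K S X Y g f (e {}) = g (f (e {}))" by (simp add: compose_def e_carrier)
  \<comment> \<open>An element of \<open>\<Phi> X\<close> vanishes on \<open>e C\<close> for
    nonempty \<open>C\<close>. Since \<open>g\<close> preserves zero, the composite has the same
    support and thus stays in the corresponding image for \<open>Y\<close>.\<close>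
  have "single_hom X {} (f (e {})) (e C) = f (e C)" for C using f(3) by simp
  then have fe: "f (e C) = (if C = {} then f (e {}) else \<zero>\<^bsub>amb X\<^esub>)" if "C \<in> I" for C
    using single_hom(2)[OF X, of "f (e {})" "{}" C] f(2) that by (simp add: meet_space_empty)
  show "HomU_map K S X Y g f = single_hom Y {} (g (f (e {})))"
    unfolding map
  proof (rule sp_hom_Usp_eqI[OF Y])
    show "compose (carrier (amb U)) g f \<in> sp_hom K S U Y"
      by (intro compose_sp_hom[where V = X] poset_space_Usp X Y g f)
    show "single_hom Y {} (g (f (e {}))) \<in> sp_hom K S U Y" by (rule single_hom[OF Y v])
    show "compose (carrier (amb U)) g f (e C) = single_hom Y {} (g (f (e {}))) (e C)" if "C \<in> I" for C
      using fe[OF that] by (simp add: single_hom(2)[OF Y v that] compose_def e_carrier)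
  qed
qed

abbreviation "\<Phi>m X Y g \<equiv> Phi_map K (ahat S) {} (HomU K S X) (HomU K S Y) (HomU_map K S X Y g)"

lemma Phi_map_mem:
  assumes X: "poset_space K S X" and Y: "poset_space K S Y" and g: "g \<in> sp_hom K S X Y"
  shows "\<Phi>m X Y g \<in> sp_hom K (ahat S) (\<Phi> X) (\<Phi> Y)"
proof (rule sp_homI)
  interpret g: linear_map K "amb X" "amb Y" g by (rule linear_map_sp_hom) fact+
  interpret PX: vectorspace K "amb (\<Phi> X)" by (rule poset_spaceD(1)[OF poset_space_Phi[OF X]])
  interpret TX: linear_map K "amb (\<Phi> X)" "amb X" "\<lambda>f. f (e {})"
    using Phi_vs_iso[OF X] by (simp add: vs_iso_def)
  interpret TY: linear_map K "amb (\<Phi> Y)" "amb Y" "\<lambda>f. f (e {})"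
    using Phi_vs_iso[OF Y] by (simp add: vs_iso_def)
  have mem: "HomU_map K S X Y g f \<in> carrier (amb (\<Phi> Y))" if "f \<in> carrier (amb (\<Phi> X))" for f
    using HomU_map_Phi(2)[OF X Y g that] Phi_carrier_e(2)[OF X that] by (simp add: Phi_HomU(1)[OF Y])
  \<comment> \<open>Elements of \<open>\<Phi> Y\<close> are determined by their value at
    \<open>e {}\<close>, so linearity of the induced map reduces to linearity of
    \<open>g\<close>.\<close>
  have eqI: "f = h" if "f \<in> carrier (amb (\<Phi> Y))" "h \<in> carrier (amb (\<Phi> Y))" "f (e {}) = h (e {})" for f h
    using Phi_carrier_e(3)[OF Y] that by metis
  note map = HomU_map_Phi(1)[OF X Y g]
  show "\<Phi>m X Y g \<in> module_hom K (amb (\<Phi> X)) (amb (\<Phi> Y))"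
    by (auto simp: module_hom_def Phi_map_def mem map PX.M.a_closed intro!: eqI)
  show "\<Phi>m X Y g \<in> extensional (carrier (amb (\<Phi> X)))" by (simp add: Phi_map_def)
  fix A f assume A: "A \<in> carrier (ahat S)" and f: "f \<in> sub (\<Phi> X) A"
  have A: "A \<in> I" using A by (rule carrier_ahat)
  have "f \<in> carrier (amb (\<Phi> X))" "f (e {}) \<in> carrier (meet_space X A)"
    using f by (auto simp: sub_Phi[OF X A])
  then show "\<Phi>m X Y g f \<in> sub (\<Phi> Y) A"
    using sp_homD(3)[OF g Ahat_subset[OF A]]
    by (auto simp: Phi_map_def sub_Phi[OF Y A] mem map carrier_meet_space)
qed

lemma is_functor_Phi:
  "is_functor (sp_cat K S :: (('k, 'v, 's) sspace, 'v) ccat) (sp_cat K (ahat S)) \<Phi> \<Phi>m"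
proof -
  have "\<Phi>m X X (\<lambda>x\<in>carrier (amb X). x) = (\<lambda>f\<in>carrier (amb (\<Phi> X)). f)"
    if X: "poset_space K S X" for X :: "('k, 'v, 's) sspace"
    unfolding Phi_map_def HomU_map_id
    by (rule restrict_ext) (simp add: Phi_carrier_e(1)[OF X])
  moreover have "\<Phi>m X Z (compose (carrier (amb X)) g f) =
      compose (carrier (amb (\<Phi> X))) (\<Phi>m Y Z g) (\<Phi>m X Y f)"
    if X: "poset_space K S X" and Y: "poset_space K S Y" and f: "f \<in> sp_hom K S X Y"
    for X Y Z :: "('k, 'v, 's) sspace" and f g
  proof -
    have "HomU_map K S X Y f h \<in> carrier (amb (\<Phi> Y))" if "h \<in> carrier (amb (\<Phi> X))" for h
      using sp_homD(4)[OF Phi_map_mem[OF X Y f] that] that by (simp add: Phi_map_def)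
    then show ?thesis
      unfolding Phi_map_def compose_def[of "carrier (amb (\<Phi> X))"] HomU_map_compose[OF X Y f]
      by (intro restrict_ext) (simp add: compose_def Phi_carrier_e(1)[OF X])
  qed
  ultimately show ?thesis
    by (simp add: is_functor_def sp_cat_def poset_space_Phi Phi_map_mem)
qed

lemma sp_iso_Phi_coind:
  assumes V: "poset_space K S V"
  shows "sp_iso K (ahat S) (\<Phi> V) (co V) (\<lambda>f\<in>carrier (amb (\<Phi> V)). f (e {}))"
proof -
  \<comment> \<open>Both maps are restricted to their domains because morphisms are required to be
    extensional.\<close>
  let ?T = "\<lambda>f\<in>carrier (amb (\<Phi> V)). f (e {})" and ?s = "\<lambda>v\<in>carrier (amb V). single_hom V {} v"
  interpret P: vectorspace K "amb (\<Phi> V)" by (rule poset_spaceD(1)[OF poset_space_Phi[OF V]])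
  interpret T: linear_map K "amb (\<Phi> V)" "amb V" "\<lambda>f. f (e {})"
    using Phi_vs_iso[OF V] by (simp add: vs_iso_def)
  have s: "single_hom V {} v \<in> carrier (amb (\<Phi> V))" if "v \<in> carrier (amb V)" for v
    using that by (simp add: Phi_HomU(1)[OF V])
  have eqI: "f = h" if "f \<in> carrier (amb (\<Phi> V))" "h \<in> carrier (amb (\<Phi> V))" "f (e {}) = h (e {})" for f h
    using Phi_carrier_e(3)[OF V] that by metis
  have "?T \<in> sp_hom K (ahat S) (\<Phi> V) (co V)"
    by (rule sp_homI) (auto simp: coind_simps[OF V] module_hom_def sub_Phi[OF V carrier_ahat] P.M.a_closed)
  moreover have "?s \<in> sp_hom K (ahat S) (co V) (\<Phi> V)"
    by (rule sp_homI)
      (auto simp: coind_simps[OF V] module_hom_def sub_Phi[OF V carrier_ahat] s single_hom_e[OF V]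
        carrier_meet_space intro!: eqI)
  ultimately show ?thesis
    using Phi_carrier_e(2,3)[OF V] s single_hom_e[OF V]
    by (auto simp: sp_iso_def coind_simps[OF V] intro!: bexI[of _ ?s])
qed

text \<open>The naturality square is the identity that evaluating the composite of \<open>g\<close>
  and f at \<open>e {}\<close> gives \<open>g\<close> of the value of f there.\<close>

lemma sp_functors_iso_Phi_coind:
  "sp_functors_iso K (ahat S) (sp_cat K S :: (('k, 'v, 's) sspace, 'v) ccat) \<Phi> \<Phi>m co coind_map"
proof -
  let ?\<eta> = "\<lambda>V::('k, 'v, 's) sspace. \<lambda>f\<in>carrier (amb (\<Phi> V)). f (e {})"
  have "?\<eta> Y (\<Phi>m X Y g f) = coind_map X Y g (?\<eta> X f)"
    if X: "poset_space K S X" and Y: "poset_space K S Y" and g: "g \<in> sp_hom K S X Y"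
      and f: "f \<in> carrier (amb (\<Phi> X))" for X Y g f
    using sp_homD(4)[OF Phi_map_mem[OF X Y g] f] HomU_map_Phi(1)[OF X Y g f] f
    by (simp add: Phi_map_def coind_map_def)
  then show ?thesis
    unfolding sp_functors_iso_def
    by (intro conjI is_functor_Phi is_functor_coind exI[of _ ?\<eta>])
      (simp_all add: sp_cat_def sp_iso_Phi_coind)
qed

end

text \<open>Functoriality in (a) is the commuting square for evaluation at 1. The identification in
  (c) has two halves: what \<open>end_mat\<close> does to a single component, and that it is an
  isomorphism of algebras. The clause on scalars ties the module structure over the incidence
  algebra to the \<open>K\<close>-structure of the Hom-space.\<close>

theorem proposition3p3:
  fixes K :: "('k, 'z) ring_scheme" and S :: "'s gorder" and V :: "('k, 'v, 's) sspace"
  assumes "field K" and "partial_order S" and "finite (carrier S)" and "poset_space K S V"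
  shows
    "\<comment> \<open>(a)\<close>
     (\<forall>A\<in>carrier (Ahat S).
        (\<forall>f\<in>lin_maps K (self_space K) (amb V).
           f \<in> sp_hom K S (kA K S A) V \<longleftrightarrow> f \<one>\<^bsub>K\<^esub> \<in> carrier (meet_space V A)) \<and>
        vs_iso K (hom_space K S (kA K S A) V) (meet_space V A) (\<lambda>f. f \<one>\<^bsub>K\<^esub>) \<and>
        (\<forall>(W :: ('k, 'v, 's) sspace) g. poset_space K S W \<and> g \<in> sp_hom K S V W \<longrightarrow>
           g ` carrier (meet_space V A) \<subseteq> carrier (meet_space W A) \<and>
           (\<forall>f\<in>sp_hom K S (kA K S A) V.
              compose (carrier K) g f \<in> sp_hom K S (kA K S A) W \<and>
              compose (carrier K) g f \<one>\<^bsub>K\<^esub> = g (f \<one>\<^bsub>K\<^esub>)))) \<and>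
     vs_iso K (hom_space K S (Usp K S) V)
       (dsum_space (carrier (Ahat S)) (meet_space V)) (rowvec K S) \<and>
     \<comment> \<open>(b)\<close>
     (\<forall>A\<in>carrier (Ahat S). \<forall>B\<in>carrier (Ahat S).
        sp_hom K S (kA K S A) (kA K S B) =
          (if B \<sqsubseteq>\<^bsub>Ahat S\<^esub> A then {\<lambda>x\<in>carrier K. c \<otimes>\<^bsub>K\<^esub> x | c. c \<in> carrier K}
           else {\<lambda>x\<in>carrier K. \<zero>\<^bsub>K\<^esub>})) \<and>
     \<comment> \<open>(c)\<close>
     (\<forall>A\<in>carrier (Ahat S). \<forall>B\<in>carrier (Ahat S). B \<sqsubseteq>\<^bsub>Ahat S\<^esub> A \<longrightarrow>
        (\<forall>h\<in>sp_hom K S (kA K S A) (kA K S B).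
           end_mat K S (\<lambda>u\<in>carrier (amb (Usp K S)). Uinj K S B (h (dsum_proj A u))) =
             h \<one>\<^bsub>K\<^esub> \<odot>\<^bsub>mat_alg K (Ahat S)\<^esub> mat_unit K (Ahat S) B A)) \<and>
     alg_iso K (end_alg K S (Usp K S)) (incidence K (inv_gorder (Ahat S))) (end_mat K S) \<and>
     left_module (incidence K (Ahat S)) (HomU K S V) \<and>
     (\<forall>c\<in>carrier K. \<forall>f\<in>carrier (HomU K S V).
        (c \<odot>\<^bsub>incidence K (Ahat S)\<^esub> \<one>\<^bsub>incidence K (Ahat S)\<^esub>) \<odot>\<^bsub>HomU K S V\<^esub> f =
          c \<odot>\<^bsub>hom_space K S (Usp K S) V\<^esub> f) \<and>
     (\<forall>A\<in>carrier (Ahat S). \<forall>B\<in>carrier (Ahat S). B \<sqsubseteq>\<^bsub>Ahat S\<^esub> A \<longrightarrow>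
        (\<forall>f\<in>carrier (HomU K S V). \<forall>v. rowvec K S f = v \<longrightarrow>
           rowvec K S (mat_unit K (Ahat S) A B \<odot>\<^bsub>HomU K S V\<^esub> f) =
             (\<lambda>C\<in>carrier (Ahat S). if C = A then v B else \<zero>\<^bsub>amb V\<^esub>))) \<and>
     \<comment> \<open>(d)\<close>
     is_functor (sp_cat K S :: (('k, 'v, 's) sspace, 'v) ccat)
       (fgmod_cat (incidence K (omega_ext (ahat S) {}))) (HomU K S) (HomU_map K S) \<and>
     sp_functors_iso K (ahat S) (sp_cat K S :: (('k, 'v, 's) sspace, 'v) ccat)
       (\<lambda>X. Phi K (ahat S) {} (HomU K S X))
       (\<lambda>X Y f. Phi_map K (ahat S) {} (HomU K S X) (HomU K S Y) (HomU_map K S X Y f))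
       (coind (ahat S) S (\<lambda>s. {s})) coind_map"
proof -
  interpret field_and_finite_poset K S using assms(1-3) by (rule field_and_finite_poset.intro)
  note V = assms(4)
  \<comment> \<open>Postcomposition with \<open>g\<close> applies \<open>g\<close> to the value at
    1, and a morphism of S-spaces maps each V(a) into W(a), hence the intersection over
    \<open>A\<close> into that of \<open>W\<close>.\<close>
  have natural: "g ` carrier (meet_space V A) \<subseteq> carrier (meet_space W A) \<and>
      (\<forall>f\<in>sp_hom K S (kA K S A) V.
        compose (carrier K) g f \<in> sp_hom K S (kA K S A) W \<and>
        compose (carrier K) g f \<one>\<^bsub>K\<^esub> = g (f \<one>\<^bsub>K\<^esub>))"
    if A: "A \<in> carrier (Ahat S)" and W: "poset_space K S W" and g: "g \<in> sp_hom K S V W"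
    for A and W :: "('k, 'v, 's) sspace" and g
  proof -
    have "carrier (amb (kA K S A)) = carrier K" by (simp add: kA_def self_space_def)
    then have "compose (carrier K) g f \<in> sp_hom K S (kA K S A) W" if "f \<in> sp_hom K S (kA K S A) V" for f
      using compose_sp_hom[OF poset_space_kA[OF A] V W g that] by simp
    then show ?thesis
      using sp_homD(3,4)[OF g] Ahat_subset[OF A] by (auto simp: carrier_meet_space compose_def)
  qed
  have action: "rowvec K S (mat_unit K (Ahat S) A B \<odot>\<^bsub>HomU K S V\<^esub> f) =
      (\<lambda>C\<in>carrier (Ahat S). if C = A then v B else \<zero>\<^bsub>amb V\<^esub>)"
    if "A \<in> carrier (Ahat S)" "B \<in> carrier (Ahat S)" "B \<sqsubseteq>\<^bsub>Ahat S\<^esub> A" "f \<in> sp_hom K S (Usp K S) V"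
      "rowvec K S f = v" for A B f v
    unfolding that(5)[symmetric] rowvec_def
    by (rule restrict_ext)
      (simp add: HomU_mat_unit_e[OF V that(4,1-3)] that(2) del: HomU_simps)
  show ?thesis
    \<comment> \<open>This turns the algebra over which (d) is stated into \<open>R\<close>, for
      which functoriality was shown.\<close>
    unfolding omega_ext_ahat
    by (intro conjI ballI allI impI; (elim conjE)?;
      (rule sp_hom_kA_iff[OF V] vs_iso_kA[OF V] vs_iso_rowvec[OF V] sp_hom_kA_kA end_mat_component
        alg_iso_end_mat left_module_HomU[OF V] is_functor_HomU sp_functors_iso_Phi_coind
      | simp add: natural action HomU_scalar del: HomU_simps(2-) incidence_simps hom_space_simps)?)
qed

end
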